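(* Let $p\in\mathbb{R}$, let $x,y\in\mathbb{R}^{m}$ (viewed in the respective dimensions), and let $G_{p}(x,y,a)=\sum_{m=2,4,6,\dots}\frac{K_{m}^{p}(x,y)\,a^{m/2-1}}{(m/2-1)!}$ be the formal generating function of the even dimensional fractional Clifford-Fourier kernels $K_m^p(x,y)=e^{ip\Gamma_y}e^{-i(x,y)}$. Let \[ \beta_{\pm}= (-i(x,y)+ae^{ip})\cos p\pm \sin p\,\sqrt{-|x|^{2}|y|^{2}-(i(x,y)-ae^{ip})^{2}}, \] \[ B=\begin{pmatrix}-\beta_{+}&0\\-(-yx\sin p +i(x,y)e^{ip}-ae^{2ip}+\beta_{+})&-\beta_{-}\end{pmatrix}, \] $c=(i(x,y)-ae^{ip})\cos p$ and $d=\sin p\sqrt{|x|^{2}|y|^{2}+(i(x,y)-ae^{ip})^{2}}$. Then \[ G_{p}(x,y,a)=\begin{pmatrix}0&1\end{pmatrix}e^{-B}\begin{pmatrix}1\\1\end{pmatrix}=e^{-c}\Big(\cos d+\frac{(x\wedge y-iae^{ip})\sin p}{d}\sin d\Big). \]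
   Context: $\mathcal{C}\ell_{0,m}$ is the real Clifford algebra generated by an orthonormal basis $e_1,\dots,e_m$ of $\mathbb{R}^m$ with $e_ie_j+e_je_i=-2\delta_{ij}$, complexified as $\mathbb{C}\otimes\mathcal{C}\ell_{0,m}$; vectors are embedded via $x=\sum_j x_je_j$ and $yx$ is a Clifford product. $(x,y)=\sum_j x_jy_j$, $|x|$ is the Euclidean norm, $x\wedge y:=\sum_{j<k}e_je_k(x_jy_k-x_ky_j)$, and $\frac{x\wedge y}{|x\wedge y|}$ squares to $-1$, so the kernels of all even dimensions can be regarded as functions of $(x,y)$, $|x||y|$ and $x\wedge y$ and summed. The Gamma operator is $\Gamma_{y}:=-\sum_{j<k}e_{j}e_{k}(y_{j}\partial_{y_{k}}-y_{k}\partial_{y_{j}})$ and $e^{ip\Gamma_y}$ its operator exponential. "Formal generating function" means the kernels are recovered from derivatives in $a$ at $a=0$. The matrix exponential is $e^{-B}=\sum_{n\ge0}(-B)^n/n!$. *)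

theory Defs
  imports "HOL-Analysis.Analysis"
begin

text \<open>Complexified Clifford algebra Cl_{0,m}, with m = CARD('n).  An element is the vector
 of its coefficients with respect to the basis blades e_A = e_{a1} ... e_{ak}
 (a1 < ... < ak, A = {a1,...,ak}).\<close>

type_synonym 'n clif = "complex ^ ('n set)"

definition blade :: "'n::{finite,linorder} set \<Rightarrow> 'n clif" where
  "blade A = (\<chi> C. if C = A then 1 else 0)"

definition scal :: "complex \<Rightarrow> 'n::{finite,linorder} clif" where
  "scal z = z *s blade {}"

text \<open>Sign of e_A e_B = sgn_bl A B e_{A symmetric difference B}, using e_i e_j = - e_j e_i (i ~= j)
 and e_i e_i = -1.\<close>
definition sgn_bl :: "'n::{finite,linorder} set \<Rightarrow> 'n set \<Rightarrow> complex" where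
  "sgn_bl A B = (-1) ^ (card {(a, b). a \<in> A \<and> b \<in> B \<and> b < a} + card (A \<inter> B))"

definition cmul :: "'n::{finite,linorder} clif \<Rightarrow> 'n clif \<Rightarrow> 'n clif" where
  "cmul u v = (\<chi> C. \<Sum>A\<in>UNIV. \<Sum>B\<in>UNIV.
      if (A - B) \<union> (B - A) = C then sgn_bl A B * u $ A * v $ B else 0)"

definition vec_cl :: "real ^ ('n::{finite,linorder}) \<Rightarrow> 'n clif" where
  "vec_cl x = (\<Sum>j\<in>UNIV. complex_of_real (x $ j) *s blade {j})"

definition wedge :: "real ^ ('n::{finite,linorder}) \<Rightarrow> real ^ ('n::{finite,linorder}) \<Rightarrow> 'n clif" where
  "wedge x y = (\<Sum>j\<in>UNIV. \<Sum>k\<in>UNIV.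
      if j < k then complex_of_real (x $ j * y $ k - x $ k * y $ j) *s blade {j, k} else 0)"

definition partial :: "(real ^ ('n::{finite,linorder}) \<Rightarrow> 'n clif) \<Rightarrow> 'n \<Rightarrow> real ^ ('n::{finite,linorder}) \<Rightarrow> 'n clif" where
  "partial f k y = vector_derivative (\<lambda>t::real. f (y + t *\<^sub>R axis k 1)) (at 0)"

definition Gamma_op :: "(real ^ ('n::{finite,linorder}) \<Rightarrow> 'n clif) \<Rightarrow> real ^ ('n::{finite,linorder}) \<Rightarrow> 'n clif" where
  "Gamma_op f y = - (\<Sum>j\<in>UNIV. \<Sum>k\<in>UNIV.
      if j < k then cmul (blade {j, k}) ((y $ j) *\<^sub>R partial f k y - (y $ k) *\<^sub>R partial f j y)
      else 0)"

definition exp_iGamma :: "real \<Rightarrow> (real ^ ('n::{finite,linorder}) \<Rightarrow> 'n clif) \<Rightarrow> real ^ ('n::{finite,linorder}) \<Rightarrow> 'n clif" where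
  "exp_iGamma p f y = (\<Sum>n. ((\<i> * complex_of_real p) ^ n / fact n) *s (Gamma_op ^^ n) f y)"

definition FCF_kernel :: "real \<Rightarrow> real ^ ('n::{finite,linorder}) \<Rightarrow> real ^ ('n::{finite,linorder}) \<Rightarrow> 'n clif" where
  "FCF_kernel p x y = exp_iGamma p (\<lambda>y'. scal (exp (- \<i> * complex_of_real (x \<bullet> y')))) y"

text \<open>2x2 matrices with Clifford entries, ((a,b),(c,d)) = [[a,b],[c,d]].\<close>
type_synonym 'n cmat = "('n clif \<times> 'n clif) \<times> ('n clif \<times> 'n clif)"

fun mmul :: "'n::{finite,linorder} cmat \<Rightarrow> 'n cmat \<Rightarrow> 'n cmat" where
  "mmul ((a, b), (c, d)) ((e, f), (g, h)) =
     ((cmul a e + cmul b g, cmul a f + cmul b h), (cmul c e + cmul d g, cmul c f + cmul d h))"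

primrec mpow :: "'n::{finite,linorder} cmat \<Rightarrow> nat \<Rightarrow> 'n cmat" where
  "mpow M 0 = ((scal 1, 0), (0, scal 1))"
| "mpow M (Suc n) = mmul (mpow M n) M"

definition mexp :: "'n::{finite,linorder} cmat \<Rightarrow> 'n cmat" where
  "mexp M = (\<Sum>n. (1 / fact n) *\<^sub>R mpow M n)"

text \<open>(0 1) M (1 1)^T\<close>
fun row2_sum :: "'n::{finite,linorder} cmat \<Rightarrow> 'n clif" where
  "row2_sum ((a, b), (c, d)) = c + d"

definition sinc :: "complex \<Rightarrow> complex" where
  "sinc z = (if z = 0 then 1 else sin z / z)"

definition beta_pm :: "bool \<Rightarrow> real \<Rightarrow> real ^ ('n::{finite,linorder}) \<Rightarrow> real ^ ('n::{finite,linorder}) \<Rightarrow> complex \<Rightarrow> complex" where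
  "beta_pm s p x y a =
     (- \<i> * complex_of_real (x \<bullet> y) + a * exp (\<i> * complex_of_real p)) * complex_of_real (cos p)
     + (if s then 1 else -1) * complex_of_real (sin p) *
       csqrt (- complex_of_real ((norm x)\<^sup>2 * (norm y)\<^sup>2)
              - (\<i> * complex_of_real (x \<bullet> y) - a * exp (\<i> * complex_of_real p))\<^sup>2)"

definition B_mat :: "real \<Rightarrow> real ^ ('n::{finite,linorder}) \<Rightarrow> real ^ ('n::{finite,linorder}) \<Rightarrow> complex \<Rightarrow> 'n cmat" where
  "B_mat p x y a =
     ((scal (- beta_pm True p x y a), 0),
      (- ( - (sin p) *\<^sub>R cmul (vec_cl y) (vec_cl x)
           + scal (\<i> * complex_of_real (x \<bullet> y) * exp (\<i> * complex_of_real p)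
                   - a * exp (2 * \<i> * complex_of_real p) + beta_pm True p x y a)),
       scal (- beta_pm False p x y a)))"

definition G_matrix :: "real \<Rightarrow> real ^ ('n::{finite,linorder}) \<Rightarrow> real ^ ('n::{finite,linorder}) \<Rightarrow> complex \<Rightarrow> 'n clif" where
  "G_matrix p x y a = row2_sum (mexp (- B_mat p x y a))"

definition c_fun :: "real \<Rightarrow> real ^ ('n::{finite,linorder}) \<Rightarrow> real ^ ('n::{finite,linorder}) \<Rightarrow> complex \<Rightarrow> complex" where
  "c_fun p x y a = (\<i> * complex_of_real (x \<bullet> y) - a * exp (\<i> * complex_of_real p)) * complex_of_real (cos p)"

definition d_fun :: "real \<Rightarrow> real ^ ('n::{finite,linorder}) \<Rightarrow> real ^ ('n::{finite,linorder}) \<Rightarrow> complex \<Rightarrow> complex" where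
  "d_fun p x y a = complex_of_real (sin p) *
     csqrt (complex_of_real ((norm x)\<^sup>2 * (norm y)\<^sup>2)
            + (\<i> * complex_of_real (x \<bullet> y) - a * exp (\<i> * complex_of_real p))\<^sup>2)"

definition G_closed :: "real \<Rightarrow> real ^ ('n::{finite,linorder}) \<Rightarrow> real ^ ('n::{finite,linorder}) \<Rightarrow> complex \<Rightarrow> 'n clif" where
  "G_closed p x y a =
     exp (- c_fun p x y a) *s
       (scal (cos (d_fun p x y a))
        + (complex_of_real (sin p) * sinc (d_fun p x y a)) *s
            (wedge x y - scal (\<i> * a * exp (\<i> * complex_of_real p))))"

definition clif_deriv :: "nat \<Rightarrow> (complex \<Rightarrow> 'n::{finite,linorder} clif) \<Rightarrow> 'n clif" where
  "clif_deriv k F = (\<chi> C. (deriv ^^ k) (\<lambda>a. F a $ C) 0)"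

end

(*
  Write s = (x, y), q = |x|^2 |y|^2 and w = x wedge y. Since w^2 = s^2 - q, the operator Gamma_y in
  dimension m maps f + g w, with f and g functions of s and q, to
  ((s^2 - q) g_s + (m - 1) s g) + (f_s + (m - 2) g) w.
  For m = 2k + 2 the dimension enters only through 2k, and under the generating function the factor k
  becomes a d/da. Hence the evolution equations K_p = i Gamma_y K of all even dimensions merge into the
  single system f_p = i ((s^2 - q) g_s + s g + 2 a s g_a), g_p = i (f_s + 2 a g_a), and the closed form
  e^{-c} (cos d + (w - i a e^{ip}) sin p sin d / d) solves it. Its two coefficients are entire, because
  cos and sin z / z are even, so the exponential series of i p Gamma_y is their Taylor series in p at 0.
  The matrix exponential is lower triangular, with a divided difference of exp below the diagonal.
*)
theory Submission
  imports Defs "HOL-Complex_Analysis.Complex_Analysis"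
begin

section \<open>Associativity of the Clifford product and the square of the bivector
  \<open>wedge x y\<close>\<close>

section \<open>Clifford algebra\<close>


lemma scaleR_eq_vscale: "r *\<^sub>R (u :: 'n::{finite,linorder} clif) = complex_of_real r *s u"
  unfolding vec_eq_iff vector_scaleR_component vector_smult_component by (simp add: scaleR_conv_of_real)

lemma cmul_add_left: "cmul (u + u') v = cmul u v + cmul u' v"
  by (auto simp: cmul_def vec_eq_iff algebra_simps sum.distrib[symmetric] intro!: sum.cong)

lemma cmul_add_right: "cmul u (v + v') = cmul u v + cmul u v'"
  by (auto simp: cmul_def vec_eq_iff algebra_simps sum.distrib[symmetric] intro!: sum.cong)

lemma cmul_vscale_left: "cmul (z *s u) v = z *s cmul u v"
  by (auto simp: cmul_def vec_eq_iff algebra_simps sum_distrib_left intro!: sum.cong)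

lemma cmul_vscale_right: "cmul u (z *s v) = z *s cmul u v"
  by (auto simp: cmul_def vec_eq_iff algebra_simps sum_distrib_left intro!: sum.cong)

lemma cmul_zero [simp]: "cmul 0 v = 0" "cmul u 0 = 0"
  using cmul_vscale_left[of 0 0 v] cmul_vscale_right[of u 0 0] by simp_all

lemma cmul_minus_left: "cmul (- u) v = - cmul u v"
  using cmul_vscale_left[of "-1" u v] by simp

lemma cmul_minus_right: "cmul u (- v) = - cmul u v"
  using cmul_vscale_right[of u "-1" v] by simp

lemma cmul_diff_right: "cmul u (v - v') = cmul u v - cmul u v'"
  using cmul_add_right[of u v "- v'"] by (simp add: cmul_minus_right)

lemma cmul_diff_left: "cmul (u - u') v = cmul u v - cmul u' v"
  using cmul_add_left[of u "- u'" v] by (simp add: cmul_minus_left)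

lemma cmul_sum_left: "cmul (\<Sum>i\<in>I. f i) v = (\<Sum>i\<in>I. cmul (f i) v)"
  by (induction I rule: infinite_finite_induct) (auto simp: cmul_add_left)

lemma cmul_sum_right: "cmul u (\<Sum>i\<in>I. f i) = (\<Sum>i\<in>I. cmul u (f i))"
  by (induction I rule: infinite_finite_induct) (auto simp: cmul_add_right)

lemmas cmul_linear = cmul_add_left cmul_add_right cmul_vscale_left cmul_vscale_right
  cmul_minus_left cmul_minus_right cmul_diff_left cmul_diff_right cmul_sum_left cmul_sum_right

lemma vscale_sum: "z *s (\<Sum>i\<in>I. f i) = (\<Sum>i\<in>I. z *s (f i :: complex ^ 'k))"
  by (induction I rule: infinite_finite_induct) (auto simp: vector_add_ldistrib)

lemma sum_vscale: "(\<Sum>i\<in>I. f i) *s (v :: complex ^ 'k) = (\<Sum>i\<in>I. f i *s v)"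
  by (induction I rule: infinite_finite_induct) (auto simp: vector_sadd_rdistrib)

lemma cmul_blade: "cmul (blade A) (blade B) = sgn_bl A B *s blade (sym_diff A B)"
proof -
  have "(\<Sum>A'\<in>UNIV. \<Sum>B'\<in>UNIV. if sym_diff A' B' = C then sgn_bl A' B' * blade A $ A' * blade B $ B' else 0)
     = (if C = sym_diff A B then sgn_bl A B else 0)" for C
  proof -
    have "(\<Sum>A'\<in>UNIV. \<Sum>B'\<in>UNIV. if sym_diff A' B' = C then sgn_bl A' B' * blade A $ A' * blade B $ B' else 0)
       = (\<Sum>A'\<in>UNIV. \<Sum>B'\<in>UNIV. if B' = B then (if A' = A then (if C = sym_diff A B then sgn_bl A B else 0) else 0) else 0)"
      by (intro sum.cong refl) (auto simp: blade_def)
    then show ?thesis by (simp add: sum.delta)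
  qed
  then show ?thesis
    unfolding cmul_def by (simp add: vec_eq_iff) (simp add: blade_def)
qed

lemma blade_expansion: "(\<Sum>A\<in>UNIV. u $ A *s blade A) = u"
proof -
  have "(\<Sum>A\<in>UNIV. u $ A * blade A $ C) = u $ C" for C
    by (simp add: blade_def if_distrib sum.delta cong: if_cong)
  then show ?thesis by (simp add: vec_eq_iff)
qed

text \<open>An inversion \<open>b < a\<close> and a repeated generator \<open>b = a\<close> each
  cost one factor -1, so the two counts merge into the single condition \<open>b \<le> a\<close>. In
  this form the sign splits over either argument.\<close>

lemma sgn_bl_eq_prod: "sgn_bl A B = (\<Prod>a\<in>A. \<Prod>b\<in>B. if b \<le> a then -1 else 1)"
proof -
  let ?S = "{(a, b). a \<in> A \<and> b \<in> B \<and> b < a}" and ?D = "(\<lambda>a. (a, a)) ` (A \<inter> B)"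
  have "card (A \<inter> B) = card ?D" by (simp add: card_image inj_on_def)
  then have "card ?S + card (A \<inter> B) = card (?S \<union> ?D)"
    by (subst card_Un_disjoint) (auto intro: finite_subset[of _ UNIV])
  also have "?S \<union> ?D = {ab \<in> A \<times> B. snd ab \<le> fst ab}" by auto
  finally have "sgn_bl A B = (\<Prod>ab\<in>A \<times> B. if snd ab \<le> fst ab then -1 else 1)"
    by (simp add: sgn_bl_def prod.If_cases Int_def)
  then show ?thesis by (simp add: prod.cartesian_product case_prod_unfold)
qed

text \<open>The common part of \<open>A\<close> and \<open>B\<close> occurs twice on the right and
  cancels, because every value of \<open>h\<close> squares to 1.\<close>

lemma prod_sym_diff:
  fixes h :: "'a :: finite \<Rightarrow> 'b :: comm_monoid_mult"
  assumes "\<And>a. h a * h a = 1"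
  shows "prod h (sym_diff A B) = prod h A * prod h B"
proof -
  have 1: "prod h A = prod h (A - B) * prod h (A \<inter> B)"
    by (subst prod.union_disjoint[symmetric]) (auto intro!: prod.cong)
  have 2: "prod h B = prod h (B - A) * prod h (A \<inter> B)"
    by (subst prod.union_disjoint[symmetric]) (auto intro!: prod.cong)
  have 3: "prod h (sym_diff A B) = prod h (A - B) * prod h (B - A)"
    by (subst prod.union_disjoint[symmetric]) auto
  have "prod h (A \<inter> B) * prod h (A \<inter> B) = 1"
    by (simp add: prod.distrib[symmetric] assms)
  then show ?thesis
    unfolding 1 2 3 by (metis (no_types, opaque_lifting) mult.assoc mult.commute mult.left_neutral)
qed

text \<open>Subsets form a group under symmetric difference, and the sign is a bicharacter on it.
  Hence both bracketings of three blades carry the product of the signs of the pairs (A, B), (A, C)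
  and (B, C), which is associativity on blades.\<close>

lemma sgn_bl_sym_diff_left: "sgn_bl (sym_diff A B) C = sgn_bl A C * sgn_bl B C"
  unfolding sgn_bl_eq_prod
  by (rule prod_sym_diff) (auto simp: prod.distrib[symmetric] intro!: prod.neutral)

lemma sgn_bl_sym_diff_right: "sgn_bl A (sym_diff B C) = sgn_bl A B * sgn_bl A C"
  unfolding sgn_bl_eq_prod prod.distrib[symmetric]
  by (intro prod.cong refl prod_sym_diff) auto

lemma cmul_blade_assoc:
  "cmul (cmul (blade A) (blade B)) (blade C) = cmul (blade A) (cmul (blade B) (blade C))"
proof -
  have "sym_diff (sym_diff A B) C = sym_diff A (sym_diff B C)" by auto
  then show ?thesis
    by (simp add: cmul_blade cmul_linear sgn_bl_sym_diff_left sgn_bl_sym_diff_right mult_ac)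
qed

lemma cmul_assoc: "cmul (cmul u v) t = cmul u (cmul v t)"
proof -
  have "cmul (cmul (\<Sum>A\<in>UNIV. u $ A *s blade A) (\<Sum>A\<in>UNIV. v $ A *s blade A)) (\<Sum>A\<in>UNIV. t $ A *s blade A)
      = cmul (\<Sum>A\<in>UNIV. u $ A *s blade A) (cmul (\<Sum>A\<in>UNIV. v $ A *s blade A) (\<Sum>A\<in>UNIV. t $ A *s blade A))"
    by (simp only: cmul_linear vscale_sum cmul_blade_assoc)
  then show ?thesis by (simp only: blade_expansion)
qed

lemma cmul_one_left: "cmul (blade {}) u = u"
proof -
  have "cmul (blade {}) (\<Sum>A\<in>UNIV. u $ A *s blade A) = (\<Sum>A\<in>UNIV. u $ A *s blade A)"
    by (simp only: cmul_linear cmul_blade) (simp add: sgn_bl_eq_prod)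
  then show ?thesis by (simp only: blade_expansion)
qed

lemma cmul_one_right: "cmul u (blade {}) = u"
proof -
  have "cmul (\<Sum>A\<in>UNIV. u $ A *s blade A) (blade {}) = (\<Sum>A\<in>UNIV. u $ A *s blade A)"
    by (simp only: cmul_linear cmul_blade) (simp add: sgn_bl_eq_prod)
  then show ?thesis by (simp only: blade_expansion)
qed

lemma generator_sq: "cmul (blade {j}) (blade {j}) = - blade {}"
  by (simp add: cmul_blade sgn_bl_eq_prod)

lemma blade_pair: "j < k \<Longrightarrow> blade {j, k} = cmul (blade {j}) (blade {k})"
  by (auto simp: cmul_blade sgn_bl_eq_prod insert_Diff_if insert_commute not_le)

lemma generators_anticommute:
  "j < k \<Longrightarrow> cmul (blade {k}) (blade {j}) = - cmul (blade {j}) (blade {k})"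
  by (auto simp: cmul_blade sgn_bl_eq_prod insert_Diff_if insert_commute)

lemma sum_split_less:
  fixes h :: "'n::{finite,linorder} \<Rightarrow> 'n \<Rightarrow> 'b::ab_group_add"
  shows "(\<Sum>j\<in>UNIV. \<Sum>k\<in>UNIV. h j k)
    = (\<Sum>j\<in>UNIV. \<Sum>k\<in>UNIV. if j < k then h j k + h k j else 0) + (\<Sum>j\<in>UNIV. h j j)"
proof -
  have "(\<Sum>j\<in>UNIV. \<Sum>k\<in>UNIV. h j k) = (\<Sum>j\<in>UNIV. \<Sum>k\<in>UNIV. (if j < k then h j k else 0)
      + (if k < j then h j k else 0) + (if k = j then h j j else 0))"
    by (intro sum.cong refl) auto
  also have "\<dots> = (\<Sum>j\<in>UNIV. \<Sum>k\<in>UNIV. if j < k then h j k else 0)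
      + (\<Sum>j\<in>UNIV. \<Sum>k\<in>UNIV. if k < j then h j k else 0) + (\<Sum>j\<in>UNIV. h j j)"
    by (simp add: sum.distrib sum.delta)
  also have "(\<Sum>j\<in>UNIV. \<Sum>k\<in>UNIV. if k < j then h j k else 0)
      = (\<Sum>j\<in>UNIV. \<Sum>k\<in>UNIV. if j < k then h k j else 0)"
    by (rule sum.swap)
  also have "(\<Sum>j\<in>UNIV. \<Sum>k\<in>UNIV. if j < k then h j k else 0)
      + (\<Sum>j\<in>UNIV. \<Sum>k\<in>UNIV. if j < k then h k j else 0)
    = (\<Sum>j\<in>UNIV. \<Sum>k\<in>UNIV. if j < k then h j k + h k j else 0)"
    by (auto simp: sum.distrib[symmetric] intro!: sum.cong)
  finally show ?thesis .
qed

lemma wedge_swap: "wedge y x = - wedge x y"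
  unfolding wedge_def sum_negf[symmetric]
  by (intro sum.cong refl) (auto simp: vec_eq_iff algebra_simps)

text \<open>Off the diagonal, the terms for (j, k) and (k, j) combine by anticommutation into the
  wedge; on the diagonal, where generators square to -1, minus the inner product remains.\<close>

lemma cmul_vec_cl: "cmul (vec_cl x) (vec_cl y) = wedge x y - scal (x \<bullet> y)"
proof -
  have "cmul (vec_cl x) (vec_cl y)
      = (\<Sum>j\<in>UNIV. \<Sum>k\<in>UNIV. complex_of_real (x $ j * y $ k) *s cmul (blade {j}) (blade {k}))"
    unfolding vec_cl_def by (subst cmul_sum_left, simp add: cmul_linear vscale_sum mult.commute)
  also have "\<dots> = wedge x y - scal (x \<bullet> y)"
  proof -
    have "(\<Sum>j\<in>UNIV. \<Sum>k\<in>UNIV. if j < k then complex_of_real (x $ j * y $ k) *s cmul (blade {j}) (blade {k})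
       + complex_of_real (x $ k * y $ j) *s cmul (blade {k}) (blade {j}) else 0) = wedge x y"
      unfolding wedge_def
      by (intro sum.cong refl) (auto simp: blade_pair generators_anticommute vec_eq_iff algebra_simps)
    moreover have "(\<Sum>j\<in>UNIV. complex_of_real (x $ j * y $ j) *s cmul (blade {j}) (blade {j})) = - scal (x \<bullet> y)"
      by (simp add: generator_sq scal_def inner_vec_def vscale_sum sum_vscale vec_eq_iff sum_negf)
    ultimately show ?thesis by (subst sum_split_less) simp
  qed
  finally show ?thesis .
qed

lemma cmul_vec_cl_swap: "cmul (vec_cl y) (vec_cl x) = - wedge x y - scal (x \<bullet> y)"
  by (simp add: cmul_vec_cl wedge_swap[of y x] inner_commute)

lemma scal_cmul: "cmul (scal z) u = z *s u" "cmul u (scal z) = z *s u"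
  by (simp_all add: scal_def cmul_linear cmul_one_left cmul_one_right)

lemma wedge_self [simp]: "wedge x x = 0"
  unfolding wedge_def by (intro sum.neutral ballI) (simp add: mult.commute)

text \<open>With s = (x, y), one factor is written as xy + s and the other as -yx - s. The vector
  squares then collapse in xyyx, and the cross terms meet in xy + yx = -2s.\<close>

lemma wedge_sq: "cmul (wedge x y) (wedge x y) = scal ((x \<bullet> y)\<^sup>2 - (norm x)\<^sup>2 * (norm y)\<^sup>2)"
proof -
  let ?X = "vec_cl x" and ?Y = "vec_cl y" and ?s = "complex_of_real (x \<bullet> y)"
  have w: "wedge x y = cmul ?X ?Y + scal ?s"
    by (simp add: cmul_vec_cl)
  have w': "wedge x y = - cmul ?Y ?X - scal ?s"
    by (simp add: cmul_vec_cl_swap[of y x])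
  have YY: "cmul ?Y (cmul ?Y u) = - complex_of_real ((norm y)\<^sup>2) *s u" for u
    by (simp add: cmul_assoc[symmetric] cmul_vec_cl cmul_linear scal_cmul power2_norm_eq_inner)
  have XX: "cmul ?X ?X = - scal ((norm x)\<^sup>2)"
    by (simp add: cmul_vec_cl power2_norm_eq_inner)
  have "cmul (wedge x y) (wedge x y) = cmul (cmul ?X ?Y + scal ?s) (- cmul ?Y ?X - scal ?s)"
    using w w' by metis
  also have "\<dots> = - cmul ?X (cmul ?Y (cmul ?Y ?X)) - ?s *s (cmul ?X ?Y + cmul ?Y ?X) - scal (?s\<^sup>2)"
    by (simp add: cmul_linear cmul_assoc scal_cmul, simp add: scal_def vec_eq_iff algebra_simps power2_eq_square)
  also have "\<dots> = scal ((x \<bullet> y)\<^sup>2 - (norm x)\<^sup>2 * (norm y)\<^sup>2)"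
    by (simp add: YY cmul_linear XX, simp add: cmul_vec_cl wedge_swap[of y x] inner_commute[of y x] scal_def vec_eq_iff algebra_simps power2_eq_square)
  finally show ?thesis .
qed

section \<open>The Gamma operator on functions of the form f + g w\<close>

section \<open>The Gamma operator\<close>


lemma wedge_add_right: "wedge x (y + z) = wedge x y + wedge x z"
  unfolding wedge_def sum.distrib[symmetric]
  by (intro sum.cong refl) (auto simp: vec_eq_iff algebra_simps)

lemma wedge_scaleR_right: "wedge x (r *\<^sub>R y) = r *\<^sub>R wedge x y"
  unfolding wedge_def scaleR_sum_right
  by (intro sum.cong refl) (auto simp: scaleR_eq_vscale vec_eq_iff algebra_simps)

text \<open>Each index lies in m - 1 unordered pairs, where m is the dimension; formally this is
  \<open>sum_split_less\<close> for a summand constant in its second index.\<close>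

lemma sum_offdiagonal_less:
  fixes h :: "'n::{finite,linorder} \<Rightarrow> 'b::real_vector"
  shows "(\<Sum>j\<in>UNIV. \<Sum>k\<in>UNIV. if j < k then h j + h k else 0) = (real CARD('n) - 1) *\<^sub>R (\<Sum>j\<in>UNIV. h j)"
proof -
  have "(\<Sum>j\<in>(UNIV::'n set). \<Sum>k\<in>(UNIV::'n set). h j)
      = (\<Sum>j\<in>UNIV. \<Sum>k\<in>UNIV. if j < k then h j + h k else 0) + (\<Sum>j\<in>UNIV. h j)"
    by (rule sum_split_less)
  moreover have "(\<Sum>j\<in>(UNIV::'n set). \<Sum>k\<in>(UNIV::'n set). h j) = real CARD('n) *\<^sub>R (\<Sum>j\<in>UNIV. h j)"
    by (simp add: sum_constant_scaleR scaleR_sum_right)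
  ultimately show ?thesis by (simp add: algebra_simps)
qed

lemma vec_cl_axis: "vec_cl (axis (k :: 'n::{finite,linorder}) 1) = blade {k}"
proof -
  have "vec_cl (axis k 1) = (\<Sum>j\<in>UNIV. if j = k then blade {j} else 0)"
    unfolding vec_cl_def by (intro sum.cong refl) (auto simp: axis_def)
  then show ?thesis by simp
qed

text \<open>Since \<open>wedge x y\<close> is linear in \<open>y\<close>, this is its partial
  derivative in direction \<open>k\<close>, put as a Clifford product so that blades can be
  multiplied onto it.\<close>

lemma wedge_axis: "wedge x (axis k 1) = - cmul (blade {k}) (vec_cl x) - scal (x $ k)"
  using cmul_vec_cl_swap[of "axis k 1" x] by (simp add: vec_cl_axis inner_axis)

text \<open>The left side is Gamma applied to w = \<open>wedge x y\<close>. Each pair contributes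
  the j and k parts of the vector y, multiplied by x, and one term of w. The double sum is therefore
  (m - 1) yx + w, where yx = -w - (x, y).\<close>

lemma Gamma_wedge:
  fixes x y :: "real ^ ('n::{finite,linorder})"
  shows "- (\<Sum>j\<in>UNIV. \<Sum>k\<in>UNIV. if j < k then
        cmul (blade {j, k}) (y $ j *\<^sub>R wedge x (axis k 1) - y $ k *\<^sub>R wedge x (axis j 1)) else 0)
    = (real CARD('n) - 1) *\<^sub>R scal (x \<bullet> y) + (real CARD('n) - 2) *\<^sub>R wedge x y"
proof -
  let ?X = "vec_cl x" and ?e = "\<lambda>j. blade {j} :: 'n::{finite,linorder} clif"
  have pair: "cmul (blade {j, k}) (y $ j *\<^sub>R wedge x (axis k 1) - y $ k *\<^sub>R wedge x (axis j 1))
     = cmul (y $ j *\<^sub>R ?e j + y $ k *\<^sub>R ?e k) ?X + complex_of_real (x $ j * y $ k - x $ k * y $ j) *s blade {j, k}"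
    if "j < k" for j k
  proof -
    have 1: "cmul (?e j) (cmul (?e k) (cmul (?e k) ?X)) = - cmul (?e j) ?X"
      unfolding cmul_assoc[of "?e k", symmetric] generator_sq by (simp add: cmul_linear cmul_one_left)
    have 2: "cmul (?e j) (cmul (?e k) (cmul (?e j) ?X)) = cmul (?e k) ?X"
    proof -
      have "cmul (?e j) (cmul (?e k) (cmul (?e j) ?X)) = cmul (cmul (?e j) (cmul (?e k) (?e j))) ?X"
        by (simp add: cmul_assoc)
      also have "cmul (?e j) (cmul (?e k) (?e j)) = - cmul (cmul (?e j) (?e j)) (?e k)"
        using that by (simp add: generators_anticommute cmul_linear cmul_assoc)
      finally show ?thesis by (simp add: generator_sq cmul_linear cmul_one_left)
    qed
    show ?thesis
      unfolding wedge_axis scaleR_eq_vscale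
      by (simp add: blade_pair[OF that] cmul_linear cmul_assoc 1 2 scal_cmul)
        (simp add: vec_eq_iff algebra_simps)
  qed
  have "(\<Sum>j\<in>UNIV. \<Sum>k\<in>UNIV. if j < k then
        cmul (blade {j, k}) (y $ j *\<^sub>R wedge x (axis k 1) - y $ k *\<^sub>R wedge x (axis j 1)) else 0)
     = (\<Sum>j\<in>UNIV. \<Sum>k\<in>UNIV. (if j < k then cmul (y $ j *\<^sub>R ?e j) ?X + cmul (y $ k *\<^sub>R ?e k) ?X else 0)
       + (if j < k then complex_of_real (x $ j * y $ k - x $ k * y $ j) *s blade {j, k} else 0))"
    by (intro sum.cong refl) (simp add: pair cmul_add_left)
  also have "\<dots> = (real CARD('n) - 1) *\<^sub>R cmul (vec_cl y) ?X + wedge x y"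
    by (simp only: sum.distrib sum_offdiagonal_less wedge_def[symmetric])
      (simp only: vec_cl_def[of y] cmul_sum_left scaleR_eq_vscale)
  finally show ?thesis
    by (simp only: cmul_vec_cl_swap) (simp add: algebra_simps scaleR_2)
qed

lemma bounded_bilinear_vscale: "bounded_bilinear (\<lambda>z (u :: complex ^ 'k::finite). z *s u)"
proof
  show "\<exists>K. \<forall>z (u :: complex ^ 'k::finite). norm (z *s u) \<le> norm z * norm u * K"
  proof (intro exI allI)
    fix z :: complex and u :: "complex ^ 'k"
    have "norm (z *s u) = norm z * norm u"
      by (simp add: norm_vec_def norm_mult L2_set_right_distrib)
    then show "norm (z *s u) \<le> norm z * norm u * 1" by simp
  qed
qed (simp_all add: vec_eq_iff algebra_simps)

lemmas has_vector_derivative_vscale =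
  bounded_bilinear.has_vector_derivative[OF bounded_bilinear_vscale]

text \<open>The assumptions express the chain rule for functions of (x, y) and |y|^2: gradients lie
  in the span of x and y. Gamma annihilates radial functions, so the components along y cancel,
  while \<open>Fs\<close> and \<open>Gs\<close> acquire the left factor \<open>wedge x y\<close>,
  whose square is scalar.\<close>

lemma Gamma_op_scal_wedge:
  fixes x y :: "real ^ ('n::{finite,linorder})" and F G :: "real ^ ('n::{finite,linorder}) \<Rightarrow> complex"
  fixes Fs Fq Gs Gq :: complex
  assumes F: "\<And>k. ((\<lambda>t. F (y + t *\<^sub>R axis k 1)) has_vector_derivative (Fs * x $ k + Fq * y $ k)) (at 0)"
    and G: "\<And>k. ((\<lambda>t. G (y + t *\<^sub>R axis k 1)) has_vector_derivative (Gs * x $ k + Gq * y $ k)) (at 0)"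
  shows "Gamma_op (\<lambda>y. scal (F y) + G y *s wedge x y) y
    = scal (((x \<bullet> y)\<^sup>2 - (norm x)\<^sup>2 * (norm y)\<^sup>2) * Gs + (real CARD('n) - 1) * (x \<bullet> y) * G y)
      + (Fs + (real CARD('n) - 2) * G y) *s wedge x y"
proof -
  let ?w = "wedge x y"
  have partial: "partial (\<lambda>y. scal (F y) + G y *s wedge x y) k y
      = scal (Fs * x $ k + Fq * y $ k) + (Gs * x $ k + Gq * y $ k) *s ?w + G y *s wedge x (axis k 1)" for k
  proof -
    have "((\<lambda>t. scal (F (y + t *\<^sub>R axis k 1)) + G (y + t *\<^sub>R axis k 1) *s (?w + t *\<^sub>R wedge x (axis k 1)))
       has_vector_derivative (scal (Fs * x $ k + Fq * y $ k) + ((Gs * x $ k + Gq * y $ k) *s ?w + G y *s wedge x (axis k 1)))) (at 0)"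
      unfolding scal_def
      by (rule derivative_eq_intros has_vector_derivative_vscale F G refl | simp add: algebra_simps)+
    then show ?thesis unfolding partial_def wedge_add_right wedge_scaleR_right
      by (simp add: vector_derivative_at add.assoc)
  qed
  \<comment> \<open>Antisymmetrising in j and k removes the multiples of y and leaves a wedge
    coefficient times one element independent of the pair, plus the derivative of the wedge
    itself.\<close>
  have "cmul (blade {j, k}) ((y $ j) *\<^sub>R partial (\<lambda>y. scal (F y) + G y *s wedge x y) k y
           - (y $ k) *\<^sub>R partial (\<lambda>y. scal (F y) + G y *s wedge x y) j y)
      = - (cmul (complex_of_real (x $ j * y $ k - x $ k * y $ j) *s blade {j, k}) (scal Fs + Gs *s ?w))
       + G y *s cmul (blade {j, k}) (y $ j *\<^sub>R wedge x (axis k 1) - y $ k *\<^sub>R wedge x (axis j 1))" for j k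
  proof -
    have "(y $ j) *\<^sub>R partial (\<lambda>y. scal (F y) + G y *s wedge x y) k y
           - (y $ k) *\<^sub>R partial (\<lambda>y. scal (F y) + G y *s wedge x y) j y
       = - (complex_of_real (x $ j * y $ k - x $ k * y $ j) *s (scal Fs + Gs *s ?w))
         + G y *s (y $ j *\<^sub>R wedge x (axis k 1) - y $ k *\<^sub>R wedge x (axis j 1))"
      unfolding partial scaleR_eq_vscale by (simp add: vec_eq_iff scal_def algebra_simps)
    then show ?thesis by (simp only: cmul_linear) (simp add: vec_eq_iff algebra_simps)
  qed
  then have "Gamma_op (\<lambda>y. scal (F y) + G y *s wedge x y) y = 
     - (\<Sum>j\<in>UNIV. \<Sum>k\<in>UNIV. - cmul (if j < k then complex_of_real (x $ j * y $ k - x $ k * y $ j) *s blade {j, k} else 0) (scal Fs + Gs *s ?w)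
       + G y *s (if j < k then cmul (blade {j, k}) (y $ j *\<^sub>R wedge x (axis k 1) - y $ k *\<^sub>R wedge x (axis j 1)) else 0))"
    unfolding Gamma_op_def by (intro arg_cong[of _ _ uminus] sum.cong refl) auto
  also have "\<dots> = cmul ?w (scal Fs + Gs *s ?w) + G y *s (- (\<Sum>j\<in>UNIV. \<Sum>k\<in>UNIV. if j < k then
        cmul (blade {j, k}) (y $ j *\<^sub>R wedge x (axis k 1) - y $ k *\<^sub>R wedge x (axis j 1)) else 0))"
    by (simp only: sum.distrib sum_negf cmul_sum_left[symmetric] vscale_sum[symmetric] wedge_def[symmetric])
     (simp add: vec_eq_iff)
  also have "\<dots> = Fs *s ?w + Gs *s scal ((x \<bullet> y)\<^sup>2 - (norm x)\<^sup>2 * (norm y)\<^sup>2)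
      + G y *s ((real CARD('n) - 1) *\<^sub>R scal (x \<bullet> y) + (real CARD('n) - 2) *\<^sub>R ?w)"
    by (simp only: Gamma_wedge) (simp only: cmul_add_right cmul_vscale_right scal_cmul wedge_sq)
  finally show ?thesis
    by (simp add: scal_def scaleR_eq_vscale vec_eq_iff algebra_simps)
qed

section \<open>Commuting partial derivatives on a class of entire functions\<close>

section \<open>Partial derivatives of elementary entire functions\<close>


text \<open>On this class mixed partial derivatives commute by induction, without any appeal to second-order
  differentiability of general functions of several variables.\<close>

inductive elementary :: "(('v \<Rightarrow> complex) \<Rightarrow> complex) \<Rightarrow> bool" where
  const: "elementary (\<lambda>\<rho>. c)"
| coord: "elementary (\<lambda>\<rho>. \<rho> v)"
| add: "elementary F \<Longrightarrow> elementary G \<Longrightarrow> elementary (\<lambda>\<rho>. F \<rho> + G \<rho>)"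
| mult: "elementary F \<Longrightarrow> elementary G \<Longrightarrow> elementary (\<lambda>\<rho>. F \<rho> * G \<rho>)"
| compose: "f holomorphic_on UNIV \<Longrightarrow> elementary F \<Longrightarrow> elementary (\<lambda>\<rho>. f (F \<rho>))"

definition pd :: "'v \<Rightarrow> (('v \<Rightarrow> complex) \<Rightarrow> complex) \<Rightarrow> ('v \<Rightarrow> complex) \<Rightarrow> complex" where
  "pd v F \<rho> = deriv (\<lambda>z. F (\<rho>(v := z))) (\<rho> v)"

lemma bounded_linear_axis: "bounded_linear (axis i :: 'b::real_normed_vector \<Rightarrow> 'b ^ 'n)"
proof
  show "\<exists>K. \<forall>x. norm (axis i x :: 'b ^ 'n) \<le> norm x * K"
    by (intro exI[of _ 1]) (simp add: norm_vec_def L2_set_def axis_def if_distrib[of norm] if_distrib[of "\<lambda>z. z\<^sup>2"] cong: if_cong)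
qed (simp_all add: vec_eq_iff axis_def)

text \<open>A vector is the sum of its components placed on the axes, and this placement is bounded
  linear.\<close>

lemma has_derivative_vec:
  fixes f :: "'a::real_normed_vector \<Rightarrow> 'b::real_normed_vector ^ 'n"
  assumes "\<And>i. ((\<lambda>x. f x $ i) has_derivative (\<lambda>h. f' h $ i)) (at x within S)"
  shows "(f has_derivative f') (at x within S)"
proof -
  have "u = (\<Sum>i\<in>UNIV. axis i (u $ i))" for u :: "'b ^ 'n"
    by (simp add: vec_eq_iff axis_def)
  then have "f = (\<lambda>x. \<Sum>i\<in>UNIV. axis i (f x $ i))" "f' = (\<lambda>h. \<Sum>i\<in>UNIV. axis i (f' h $ i))"
    by (auto intro: ext)
  moreover have "((\<lambda>x. \<Sum>i\<in>UNIV. axis i (f x $ i)) has_derivative (\<lambda>h. \<Sum>i\<in>UNIV. axis i (f' h $ i))) (at x within S)"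
    by (intro has_derivative_sum bounded_linear.has_derivative[OF bounded_linear_axis] assms)
  ultimately show ?thesis by simp
qed

text \<open>The total derivative is carried through the induction because the chain rule along
  curves requires it; \<open>($)\<close> moves the variables into the normed space
  \<open>complex ^ 'v\<close>. That the partials stay in the class permits iteration.\<close>

lemma elementary_partials:
  fixes F :: "('v::finite \<Rightarrow> complex) \<Rightarrow> complex"
  assumes "elementary F"
  shows "\<exists>F'. (\<forall>v. elementary (F' v)) \<and>
    (\<forall>r :: complex ^ 'v. ((\<lambda>r. F (($) r)) has_derivative (\<lambda>h. \<Sum>v\<in>UNIV. F' v (($) r) * h $ v)) (at r))"
  using assms
proof induction
  case (const c)
  show ?case by (rule exI[of _ "\<lambda>_ _. 0"]) (auto intro: elementary.const)
next
  case (coord u)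
  have "((\<lambda>r. r $ u) has_derivative (\<lambda>h. \<Sum>v\<in>UNIV. (if v = u then 1 else 0) * h $ v)) (at r)" for r :: "complex ^ 'v"
    by (simp add: if_distrib[of "\<lambda>z. z * _"] bounded_linear_vec_nth bounded_linear_imp_has_derivative cong: if_cong)
  then show ?case
    by (intro exI[of _ "\<lambda>v _. if v = u then 1 else 0"]) (auto intro: elementary.const)
next
  case (add F G)
  from add.IH(1) obtain F' where
    F': "\<And>v. elementary (F' v)" "\<And>r :: complex ^ 'v.
      ((\<lambda>r. F (($) r)) has_derivative (\<lambda>h. \<Sum>v\<in>UNIV. F' v (($) r) * h $ v)) (at r)"
    by blast
  from add.IH(2) obtain G' where
    G': "\<And>v. elementary (G' v)" "\<And>r :: complex ^ 'v.
      ((\<lambda>r. G (($) r)) has_derivative (\<lambda>h. \<Sum>v\<in>UNIV. G' v (($) r) * h $ v)) (at r)"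
    by blast
  have "((\<lambda>r. F (($) r) + G (($) r)) has_derivative
      (\<lambda>h. \<Sum>v\<in>UNIV. (F' v (($) r) + G' v (($) r)) * h $ v)) (at r)" for r :: "complex ^ 'v"
    using has_derivative_add[OF F'(2) G'(2)] by (simp add: sum.distrib algebra_simps)
  then show ?case
    using F'(1) G'(1) by (intro exI[of _ "\<lambda>v \<rho>. F' v \<rho> + G' v \<rho>"]) (auto intro: elementary.add)
next
  case (mult F G)
  from mult.IH(1) obtain F' where
    F': "\<And>v. elementary (F' v)" "\<And>r :: complex ^ 'v.
      ((\<lambda>r. F (($) r)) has_derivative (\<lambda>h. \<Sum>v\<in>UNIV. F' v (($) r) * h $ v)) (at r)"
    by blast
  from mult.IH(2) obtain G' where
    G': "\<And>v. elementary (G' v)" "\<And>r :: complex ^ 'v.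
      ((\<lambda>r. G (($) r)) has_derivative (\<lambda>h. \<Sum>v\<in>UNIV. G' v (($) r) * h $ v)) (at r)"
    by blast
  have "((\<lambda>r. F (($) r) * G (($) r)) has_derivative
      (\<lambda>h. \<Sum>v\<in>UNIV. (F' v (($) r) * G (($) r) + F (($) r) * G' v (($) r)) * h $ v)) (at r)" for r :: "complex ^ 'v"
    by (rule has_derivative_eq_rhs[OF has_derivative_mult[OF F'(2) G'(2)]])
      (simp add: sum.distrib sum_distrib_left sum_distrib_right algebra_simps)
  then show ?case
    using F'(1) G'(1) mult.hyps by (intro exI[of _ "\<lambda>v \<rho>. F' v \<rho> * G \<rho> + F \<rho> * G' v \<rho>"])
      (auto intro!: elementary.add elementary.mult)
next
  case (compose f F)
  then obtain F' where
    F': "\<And>v. elementary (F' v)" "\<And>r :: complex ^ 'v.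
      ((\<lambda>r. F (($) r)) has_derivative (\<lambda>h. \<Sum>v\<in>UNIV. F' v (($) r) * h $ v)) (at r)"
    by blast
  have f': "(f has_derivative (*) (deriv f z)) (at z)" for z
    using compose.hyps(1) holomorphic_derivI[of f UNIV z UNIV] by (simp add: has_field_derivative_def)
  have "((\<lambda>r. f (F (($) r))) has_derivative
      (\<lambda>h. \<Sum>v\<in>UNIV. (deriv f (F (($) r)) * F' v (($) r)) * h $ v)) (at r)" for r :: "complex ^ 'v"
    by (rule has_derivative_eq_rhs[OF has_derivative_compose[OF F'(2) f']])
      (simp add: sum_distrib_left algebra_simps)
  moreover have "elementary (\<lambda>\<rho>. deriv f (F \<rho>))"
    using compose.hyps by (intro elementary.compose[of "deriv f"]) (auto intro: holomorphic_deriv)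
  ultimately show ?case
    using F'(1) by (intro exI[of _ "\<lambda>v \<rho>. deriv f (F \<rho>) * F' v \<rho>"]) (auto intro: elementary.mult)
qed

lemma has_derivative_fun_upd:
  "((\<lambda>z. (\<rho>(v := z)) u) has_derivative (\<lambda>h. if u = v then h else 0)) (at t)"
  by (cases "u = v") auto

text \<open>Uniqueness of one-variable derivatives identifies \<open>pd v F\<close> with the
  coefficient supplied by \<open>elementary_partials\<close>. The last claim is the chain rule along
  a real curve.\<close>

lemma
  fixes F :: "('v::finite \<Rightarrow> complex) \<Rightarrow> complex"
  assumes "elementary F"
  shows elementary_pd [intro]: "elementary (pd v F)"
    and has_field_derivative_pd: "((\<lambda>z. F (\<rho>(v := z))) has_field_derivative pd v F (\<rho>(v := t))) (at t)"
    and has_vector_derivative_elementary: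
      "(\<And>v. ((\<lambda>t. \<sigma> t v) has_vector_derivative \<sigma>' v) (at s)) \<Longrightarrow>
       ((\<lambda>t. F (\<sigma> t)) has_vector_derivative (\<Sum>v\<in>UNIV. pd v F (\<sigma> s) * \<sigma>' v)) (at s)"
proof -
  obtain F' where F': "\<And>v. elementary (F' v)" "\<And>r :: complex ^ 'v.
      ((\<lambda>r. F (($) r)) has_derivative (\<lambda>h. \<Sum>v\<in>UNIV. F' v (($) r) * h $ v)) (at r)"
    using elementary_partials[OF assms] by blast
  have vec: "($) (\<chi> v. \<rho> v) = \<rho>" for \<rho> :: "'v \<Rightarrow> complex"
    by (simp add: fun_eq_iff)
  have F'_field: "((\<lambda>z. F (\<rho>(v := z))) has_field_derivative F' v (\<rho>(v := t))) (at t)" for \<rho> v t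
  proof -
    have "((\<lambda>z. \<chi> u. (\<rho>(v := z)) u) has_derivative (\<lambda>h. \<chi> u. if u = v then h else 0)) (at t)"
      by (rule has_derivative_vec) (auto intro: has_derivative_fun_upd simp del: fun_upd_apply)
    from has_derivative_compose[OF this F'(2)] show ?thesis
      unfolding has_field_derivative_def vec
      by (rule has_derivative_eq_rhs) (simp add: fun_eq_iff if_distrib[of "\<lambda>z. _ * z"] cong: if_cong)
  qed
  have pd: "pd v F = F' v" for v
    using DERIV_imp_deriv[OF F'_field] by (auto simp: pd_def)
  show "elementary (pd v F)"
    using F'(1) pd by simp
  show "((\<lambda>z. F (\<rho>(v := z))) has_field_derivative pd v F (\<rho>(v := t))) (at t)"
    using F'_field pd by simp
  assume "\<And>v. ((\<lambda>t. \<sigma> t v) has_vector_derivative \<sigma>' v) (at s)"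
  then have "((\<lambda>t. \<chi> v. \<sigma> t v) has_derivative (\<lambda>h. \<chi> v. h *\<^sub>R \<sigma>' v)) (at s)"
    by (intro has_derivative_vec) (auto simp: has_vector_derivative_def)
  from has_derivative_compose[OF this F'(2)]
  show "((\<lambda>t. F (\<sigma> t)) has_vector_derivative (\<Sum>v\<in>UNIV. pd v F (\<sigma> s) * \<sigma>' v)) (at s)"
    unfolding has_vector_derivative_def vec pd
    by (rule has_derivative_eq_rhs) (simp add: fun_eq_iff scaleR_sum_right)
qed

lemma elementary_uminus: "elementary F \<Longrightarrow> elementary (\<lambda>\<rho>. - F \<rho>)"
  by (rule elementary.compose[of uminus]) (auto intro: holomorphic_intros)

lemma elementary_diff: "elementary F \<Longrightarrow> elementary G \<Longrightarrow> elementary (\<lambda>\<rho>. F \<rho> - G \<rho>)"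
  using elementary.add[of F "\<lambda>\<rho>. - G \<rho>"] by (simp add: elementary_uminus)

lemma elementary_power: "elementary F \<Longrightarrow> elementary (\<lambda>\<rho>. F \<rho> ^ n)"
  by (rule elementary.compose[of "\<lambda>z. z ^ n"]) (auto intro: holomorphic_intros)

lemma pd_const [simp]: "pd v (\<lambda>\<rho>. c) = (\<lambda>\<rho>. 0)"
  by (simp add: pd_def fun_eq_iff)

lemma pd_coord: "pd v (\<lambda>\<rho>. \<rho> u) = (\<lambda>\<rho>. if u = v then 1 else 0)"
  by (simp add: pd_def fun_eq_iff)

lemma pd_add:
  fixes v :: "'v::finite"
  assumes "elementary F" "elementary G"
  shows "pd v (\<lambda>\<rho>. F \<rho> + G \<rho>) = (\<lambda>\<rho>. pd v F \<rho> + pd v G \<rho>)"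
  using DERIV_imp_deriv[OF DERIV_add[OF has_field_derivative_pd[OF assms(1)] has_field_derivative_pd[OF assms(2)]]]
  by (auto simp: pd_def[of v "\<lambda>\<rho>. F \<rho> + G \<rho>"])

lemma pd_mult:
  fixes v :: "'v::finite"
  assumes "elementary F" "elementary G"
  shows "pd v (\<lambda>\<rho>. F \<rho> * G \<rho>) = (\<lambda>\<rho>. F \<rho> * pd v G \<rho> + pd v F \<rho> * G \<rho>)"
  using DERIV_imp_deriv[OF DERIV_mult'[OF has_field_derivative_pd[OF assms(1)] has_field_derivative_pd[OF assms(2)]]]
  by (auto simp: pd_def[of v "\<lambda>\<rho>. F \<rho> * G \<rho>"])

lemma pd_compose:
  fixes v :: "'v::finite"
  assumes "f holomorphic_on UNIV" "elementary F"
  shows "pd v (\<lambda>\<rho>. f (F \<rho>)) = (\<lambda>\<rho>. deriv f (F \<rho>) * pd v F \<rho>)"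
proof -
  have "(f has_field_derivative deriv f z) (at z)" for z
    using assms(1) by (auto intro: holomorphic_derivI)
  from DERIV_imp_deriv[OF DERIV_chain2[OF this has_field_derivative_pd[OF assms(2)]]]
  show ?thesis by (auto simp: pd_def[of v "\<lambda>\<rho>. f (F \<rho>)"])
qed

text \<open>The sum, product and chain rules produce second derivatives that are symmetric in
  \<open>u\<close> and \<open>v\<close> as soon as the constituents have commuting partials.\<close>

lemma pd_commute:
  fixes F :: "('v::finite \<Rightarrow> complex) \<Rightarrow> complex"
  assumes "elementary F"
  shows "pd u (pd v F) = pd v (pd u F)"
  using assms
proof induction
  case (add F G)
  then show ?case by (simp add: pd_add elementary_pd)
next
  case (mult F G)
  then show ?case
    by (simp add: pd_mult pd_add elementary_pd elementary.mult) (simp add: algebra_simps)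
next
  case (compose f F)
  have "deriv f holomorphic_on UNIV"
    using compose.hyps(1) by (auto intro: holomorphic_deriv)
  with compose show ?case
    by (simp add: pd_compose pd_mult elementary_pd elementary.compose[of "deriv f"]) (simp add: algebra_simps)
qed (simp_all add: pd_coord)

lemma elementary_pd_funpow [intro]: "elementary F \<Longrightarrow> elementary ((pd (v :: 'v::finite) ^^ n) F)"
  by (induction n) auto

text \<open>Restriction to a coordinate line gives access to one-variable Taylor series and to the
  derivatives in \<open>clif_deriv\<close>.\<close>

lemma pd_funpow_eq: "(pd v ^^ n) F \<rho> = (deriv ^^ n) (\<lambda>z. F (\<rho>(v := z))) (\<rho> v)"
proof (induction n arbitrary: \<rho>)
  case (Suc n)
  have "(pd v ^^ Suc n) F \<rho> = deriv (\<lambda>z. (pd v ^^ n) F (\<rho>(v := z))) (\<rho> v)"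
    by (simp only: funpow.simps comp_apply pd_def[of v "(pd v ^^ n) F"])
  then show ?case by (simp only: Suc fun_upd_upd fun_upd_same funpow.simps comp_apply)
qed simp

lemma pd_funpow_commute:
  fixes F :: "('v::finite \<Rightarrow> complex) \<Rightarrow> complex"
  assumes "elementary F"
  shows "pd u ((pd v ^^ n) F) = (pd v ^^ n) (pd u F)"
  using assms by (induction n) (auto simp: pd_commute[of _ u v] elementary_pd_funpow)

lemma pd_funpow_add:
  fixes v :: "'v::finite"
  assumes "elementary F" "elementary G"
  shows "(pd v ^^ n) (\<lambda>\<rho>. F \<rho> + G \<rho>) = (\<lambda>\<rho>. (pd v ^^ n) F \<rho> + (pd v ^^ n) G \<rho>)"
  using assms by (induction n) (auto simp: pd_add elementary_pd_funpow)

lemma pd_funpow_mult_left: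
  fixes v :: "'v::finite"
  assumes "elementary H" "elementary F" "pd v H = (\<lambda>\<rho>. 0)"
  shows "(pd v ^^ n) (\<lambda>\<rho>. H \<rho> * F \<rho>) = (\<lambda>\<rho>. H \<rho> * (pd v ^^ n) F \<rho>)"
  using assms by (induction n) (auto simp: pd_mult elementary_pd_funpow)

text \<open>Leibniz rule for the Euler operator a d/da. Where the coordinate vanishes only the
  factor \<open>n\<close> survives, and through it the dimension enters the recurrence.\<close>

lemma pd_funpow_euler:
  fixes v :: "'v::finite"
  assumes "elementary F"
  shows "(pd v ^^ n) (\<lambda>\<rho>. \<rho> v * pd v F \<rho>) = (\<lambda>\<rho>. \<rho> v * (pd v ^^ Suc n) F \<rho> + of_nat n * (pd v ^^ n) F \<rho>)"
proof (induction n)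
  case (Suc n)
  have "elementary ((pd v ^^ k) F)" for k using assms by auto
  from this[of n] this[of "Suc n"] show ?case
    by (simp add: Suc pd_add pd_mult elementary_pd elementary.mult elementary.coord elementary.const pd_coord)
      (simp add: algebra_simps)
qed simp

section \<open>Cosine and sinc of a square root as entire functions\<close>

section \<open>The generating function\<close>


text \<open>Entire although \<open>csqrt\<close> is discontinuous, since the cosine is even.\<close>

definition cos_rt :: "complex \<Rightarrow> complex" where
  "cos_rt z = cos (csqrt z)"

text \<open>This is sin w / w as a function of w^2. Taking it as a derivative makes holomorphy
  immediate, at 0 as well.\<close>

definition sinc_rt :: "complex \<Rightarrow> complex" where
  "sinc_rt z = - 2 * deriv cos_rt z"

lemma cos_rt_square [simp]: "cos_rt (w\<^sup>2) = cos w"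
proof -
  have "(csqrt (w\<^sup>2))\<^sup>2 = w\<^sup>2" by simp
  then have "csqrt (w\<^sup>2) = w \<or> csqrt (w\<^sup>2) = - w" by (simp only: power2_eq_iff)
  then show ?thesis by (auto simp: cos_rt_def)
qed

text \<open>Grouping the cosine series in consecutive pairs drops the vanishing odd terms. What
  remains is a power series in \<open>z\<close> itself that converges everywhere.\<close>

lemma cos_rt_holomorphic: "cos_rt holomorphic_on UNIV"
proof -
  have sums: "(\<lambda>n. (- 1) ^ n / fact (2 * n) * (z - 0) ^ n) sums cos_rt z" for z
  proof -
    have "(\<lambda>n. \<Sum>i = n * 2..<n * 2 + 2. cos_coeff i *\<^sub>R csqrt z ^ i) sums cos (csqrt z)"
      by (intro sums_group cos_converges) auto
    moreover have "(\<Sum>i = n * 2..<n * 2 + 2. cos_coeff i *\<^sub>R csqrt z ^ i) = (- 1) ^ n / fact (2 * n) * (z - 0) ^ n" for n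
    proof -
      have "{n * 2..<n * 2 + 2} = {2 * n, Suc (2 * n)}" by auto
      then show ?thesis by (simp add: cos_coeff_def power_mult scaleR_conv_of_real)
    qed
    ultimately show ?thesis by (simp add: cos_rt_def)
  qed
  have "cos_rt holomorphic_on ball 0 r" for r
    by (rule power_series_holomorphic[OF sums])
  then have "cos_rt holomorphic_on (\<Union>r. ball 0 r)"
    by (intro holomorphic_on_UN_open) auto
  moreover have "(\<Union>r. ball (0::complex) r) = UNIV"
    by (auto intro: gt_ex)
  ultimately show ?thesis by simp
qed

lemma sinc_rt_holomorphic: "sinc_rt holomorphic_on UNIV"
  unfolding sinc_rt_def[abs_def]
  by (intro holomorphic_intros holomorphic_deriv[OF cos_rt_holomorphic]) auto

lemma DERIV_cos_rt: "(cos_rt has_field_derivative - sinc_rt z / 2) (at z)"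
  using holomorphic_derivI[OF cos_rt_holomorphic, of z UNIV] by (simp add: sinc_rt_def)

lemma DERIV_sinc_rt: "(sinc_rt has_field_derivative deriv sinc_rt z) (at z)"
  using holomorphic_derivI[OF sinc_rt_holomorphic, of z UNIV] by simp

text \<open>Both sides arise, up to sign, from differentiating
  \<open>cos_rt (w\<^sup>2) = cos w\<close>; no division by \<open>w\<close> occurs.\<close>

lemma mult_sinc_rt_square: "w * sinc_rt (w\<^sup>2) = sin w"
proof -
  have "((\<lambda>w. w\<^sup>2) has_field_derivative 2 * w) (at w)"
    by (auto intro!: derivative_eq_intros)
  from DERIV_chain2[OF DERIV_cos_rt this]
  have "(cos has_field_derivative - (w * sinc_rt (w\<^sup>2))) (at w)" by (simp add: mult.commute)
  moreover have "(cos has_field_derivative - sin w) (at w)"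
    by (auto intro!: derivative_eq_intros)
  ultimately have "- (w * sinc_rt (w\<^sup>2)) = - sin w" by (rule DERIV_unique)
  then show ?thesis by simp
qed

text \<open>Obtained by differentiating \<open>w * sinc_rt (w\<^sup>2) = sin w\<close>. It serves to
  eliminate \<open>cos_rt\<close> from the evolution equations, and at 0 it yields the value of
  \<open>sinc_rt\<close>.\<close>

lemma deriv_sinc_rt: "2 * z * deriv sinc_rt z = cos_rt z - sinc_rt z"
proof -
  define w where "w = csqrt z"
  have z: "z = w\<^sup>2" by (simp add: w_def)
  have "((\<lambda>w. w * sinc_rt (w\<^sup>2)) has_field_derivative sinc_rt (w\<^sup>2) + 2 * w\<^sup>2 * deriv sinc_rt (w\<^sup>2)) (at w)"
    by (auto intro!: derivative_eq_intros DERIV_chain2[OF DERIV_sinc_rt] simp: power2_eq_square)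
  then have "(sin has_field_derivative sinc_rt z + 2 * z * deriv sinc_rt z) (at w)"
    by (simp add: mult_sinc_rt_square z)
  moreover have "(sin has_field_derivative cos_rt z) (at w)"
    by (auto intro!: derivative_eq_intros simp: z)
  ultimately have "sinc_rt z + 2 * z * deriv sinc_rt z = cos_rt z" by (rule DERIV_unique)
  then show ?thesis by (simp add: algebra_simps)
qed

lemma sinc_rt_0 [simp]: "sinc_rt 0 = 1"
  using deriv_sinc_rt[of 0] by (simp add: cos_rt_def)

lemma sinc_rt_square: "sinc_rt (w\<^sup>2) = sinc w"
  using mult_sinc_rt_square[of w] by (auto simp: sinc_def field_simps)

section \<open>The closed form in four independent complex variables and its evolution
  equations\<close>

text \<open>The variables \<open>p\<close>, \<open>(x, y)\<close>, \<open>|x|\<^sup>2 |y|\<^sup>2\<close> and \<open>a\<close>, in this order.\<close>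

datatype coord = Ang | Inn | Nrm | Par

lemma UNIV_coord: "UNIV = {Ang, Inn, Nrm, Par}"
  by (auto intro: coord.exhaust)

instance coord :: finite
  by standard (simp add: UNIV_coord)

definition gen_u :: "(coord \<Rightarrow> complex) \<Rightarrow> complex" where
  "gen_u \<rho> = \<i> * \<rho> Inn - \<rho> Par * exp (\<i> * \<rho> Ang)"

definition gen_c :: "(coord \<Rightarrow> complex) \<Rightarrow> complex" where
  "gen_c \<rho> = gen_u \<rho> * cos (\<rho> Ang)"

text \<open>The square of d in the closed form; working with it leaves no root to choose.\<close>

definition gen_D :: "(coord \<Rightarrow> complex) \<Rightarrow> complex" where
  "gen_D \<rho> = (sin (\<rho> Ang))\<^sup>2 * (\<rho> Nrm + (gen_u \<rho>)\<^sup>2)"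

definition gen_h :: "(coord \<Rightarrow> complex) \<Rightarrow> complex" where
  "gen_h \<rho> = \<i> * \<rho> Par * exp (\<i> * \<rho> Ang) * sin (\<rho> Ang)"

text \<open>\<open>gen_f\<close> and \<open>gen_g\<close> are the coefficients of 1 and of
  \<open>wedge x y\<close> in the closed form.\<close>

definition gen_f :: "(coord \<Rightarrow> complex) \<Rightarrow> complex" where
  "gen_f \<rho> = exp (- gen_c \<rho>) * (cos_rt (gen_D \<rho>) - gen_h \<rho> * sinc_rt (gen_D \<rho>))"

definition gen_g :: "(coord \<Rightarrow> complex) \<Rightarrow> complex" where
  "gen_g \<rho> = exp (- gen_c \<rho>) * sin (\<rho> Ang) * sinc_rt (gen_D \<rho>)"

lemma elementary_gen:
  "elementary gen_u" "elementary gen_c" "elementary gen_D" "elementary gen_h" "elementary gen_f" "elementary gen_g"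
proof -
  have entire: "exp holomorphic_on UNIV" "sin holomorphic_on UNIV" "cos holomorphic_on UNIV"
    by (auto intro: holomorphic_intros)
  note intros = elementary.const elementary.coord elementary.add elementary.mult elementary_diff elementary_uminus
    elementary_power entire[THEN elementary.compose] elementary.compose[OF cos_rt_holomorphic]
    elementary.compose[OF sinc_rt_holomorphic]
  show u: "elementary gen_u" unfolding gen_u_def[abs_def] by (intro intros)
  show c: "elementary gen_c" unfolding gen_c_def[abs_def] by (intro intros u)
  show D: "elementary gen_D" unfolding gen_D_def[abs_def] by (intro intros u)
  show h: "elementary gen_h" unfolding gen_h_def[abs_def] by (intro intros)
  show "elementary gen_f" unfolding gen_f_def[abs_def] by (intro intros c D h)
  show "elementary gen_g" unfolding gen_g_def[abs_def] by (intro intros c D)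
qed

text \<open>The direction \<open>v\<close> is kept general, so that the derivatives of
  \<open>gen_c\<close>, \<open>gen_D\<close> and \<open>gen_h\<close> can be inserted for each
  variable separately.\<close>

lemma pd_gen_f:
  "pd v gen_f \<rho> = exp (- gen_c \<rho>) *
     (- pd v gen_c \<rho> * (cos_rt (gen_D \<rho>) - gen_h \<rho> * sinc_rt (gen_D \<rho>)) - sinc_rt (gen_D \<rho>) / 2 * pd v gen_D \<rho>
      - pd v gen_h \<rho> * sinc_rt (gen_D \<rho>) - gen_h \<rho> * deriv sinc_rt (gen_D \<rho>) * pd v gen_D \<rho>)"
proof -
  note [derivative_intros] = elementary_gen[THEN has_field_derivative_pd, where v = v and \<rho> = \<rho> and t = "\<rho> v", simplified fun_upd_triv]
  show ?thesis
    unfolding pd_def[of v gen_f] gen_f_def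
    by (rule DERIV_imp_deriv)
      (rule derivative_eq_intros DERIV_chain2[OF DERIV_cos_rt] DERIV_chain2[OF DERIV_sinc_rt] refl | simp add: algebra_simps)+
qed

lemma pd_gen_g:
  "pd v gen_g \<rho> = exp (- gen_c \<rho>) *
     (- pd v gen_c \<rho> * sin (\<rho> Ang) * sinc_rt (gen_D \<rho>) + (if v = Ang then cos (\<rho> Ang) else 0) * sinc_rt (gen_D \<rho>)
      + sin (\<rho> Ang) * deriv sinc_rt (gen_D \<rho>) * pd v gen_D \<rho>)"
proof -
  note [derivative_intros] = elementary_gen[THEN has_field_derivative_pd, where v = v and \<rho> = \<rho> and t = "\<rho> v", simplified fun_upd_triv]
  have [derivative_intros]: "((\<lambda>z. sin ((\<rho>(v := z)) Ang)) has_field_derivative (if v = Ang then cos (\<rho> Ang) else 0)) (at (\<rho> v))"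
    by (cases "v = Ang") (auto intro!: derivative_eq_intros)
  show ?thesis
    unfolding pd_def[of v gen_g] gen_g_def
    by (rule DERIV_imp_deriv)
      (rule derivative_eq_intros DERIV_chain2[OF DERIV_cos_rt] DERIV_chain2[OF DERIV_sinc_rt] refl | simp add: algebra_simps)+
qed

lemma pd_gen_Inn:
  "pd Inn gen_c \<rho> = \<i> * cos (\<rho> Ang)"
  "pd Inn gen_D \<rho> = 2 * \<i> * (sin (\<rho> Ang))\<^sup>2 * gen_u \<rho>"
  "pd Inn gen_h \<rho> = 0"
  unfolding pd_def gen_c_def gen_D_def gen_h_def gen_u_def
  by (rule DERIV_imp_deriv; auto intro!: derivative_eq_intros simp: algebra_simps)+

lemma pd_gen_Par:
  "pd Par gen_c \<rho> = - exp (\<i> * \<rho> Ang) * cos (\<rho> Ang)"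
  "pd Par gen_D \<rho> = - 2 * exp (\<i> * \<rho> Ang) * (sin (\<rho> Ang))\<^sup>2 * gen_u \<rho>"
  "pd Par gen_h \<rho> = \<i> * exp (\<i> * \<rho> Ang) * sin (\<rho> Ang)"
  unfolding pd_def gen_c_def gen_D_def gen_h_def gen_u_def
  by (rule DERIV_imp_deriv; auto intro!: derivative_eq_intros simp: algebra_simps)+

lemma pd_gen_Ang:
  "pd Ang gen_c \<rho> = - (\<i> * \<rho> Par * exp (\<i> * \<rho> Ang) * cos (\<rho> Ang)) - gen_u \<rho> * sin (\<rho> Ang)"
  "pd Ang gen_D \<rho> = 2 * sin (\<rho> Ang) * cos (\<rho> Ang) * (\<rho> Nrm + (gen_u \<rho>)\<^sup>2)
     - 2 * \<i> * \<rho> Par * exp (\<i> * \<rho> Ang) * (sin (\<rho> Ang))\<^sup>2 * gen_u \<rho>"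
  "pd Ang gen_h \<rho> = \<i> * \<rho> Par * exp (\<i> * \<rho> Ang) * (cos (\<rho> Ang) + \<i> * sin (\<rho> Ang))"
  unfolding pd_def gen_c_def gen_D_def gen_h_def gen_u_def
  by (rule DERIV_imp_deriv; auto intro!: derivative_eq_intros simp: algebra_simps power2_eq_square)+

text \<open>Once \<open>cos_rt\<close> is eliminated by \<open>deriv_sinc_rt\<close>, both sides are
  exp(-c) times polynomials in the abbreviations below. For the first equation the inner product is
  also expressed through \<open>u\<close>, and the cosine through \<open>E\<close> by Euler's
  formula; ring normalisation then decides.\<close>

lemma gen_pde:
  "pd Ang gen_f \<rho> = \<i> * (((\<rho> Inn)\<^sup>2 - \<rho> Nrm) * pd Inn gen_g \<rho> + \<rho> Inn * gen_g \<rho> + 2 * \<rho> Inn * (\<rho> Par * pd Par gen_g \<rho>))"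
  "pd Ang gen_g \<rho> = \<i> * (pd Inn gen_f \<rho> + 2 * (\<rho> Par * pd Par gen_g \<rho>))"
proof -
  define a q s E \<sigma> \<kappa> u where defs: "a = \<rho> Par" "q = \<rho> Nrm" "s = \<rho> Inn"
    "E = exp (\<i> * \<rho> Ang)" "\<sigma> = sin (\<rho> Ang)" "\<kappa> = cos (\<rho> Ang)" "u = gen_u \<rho>"
  define S T where ST: "S = sinc_rt (gen_D \<rho>)" "T = deriv sinc_rt (gen_D \<rho>)"
  have s: "s = - \<i> * (u + a * E)"
    by (simp add: defs gen_u_def algebra_simps)
  have E: "\<kappa> = E - \<i> * \<sigma>"
    by (simp add: defs exp_Euler)
  have D: "gen_D \<rho> = \<sigma>\<^sup>2 * (q + u\<^sup>2)"
    by (simp add: gen_D_def defs)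
  have C: "cos_rt (gen_D \<rho>) = S + 2 * (\<sigma>\<^sup>2 * (q + u\<^sup>2)) * T"
    using deriv_sinc_rt[of "gen_D \<rho>"] unfolding D[symmetric] ST by (simp add: algebra_simps)
  have h: "gen_h \<rho> = \<i> * a * E * \<sigma>"
    by (simp add: gen_h_def defs)
  have ii: "\<i> * \<i> = - 1" "\<And>z. \<i> * (\<i> * z) = - z" by simp_all
  show "pd Ang gen_f \<rho> = \<i> * (((\<rho> Inn)\<^sup>2 - \<rho> Nrm) * pd Inn gen_g \<rho> + \<rho> Inn * gen_g \<rho> + 2 * \<rho> Inn * (\<rho> Par * pd Par gen_g \<rho>))"
    unfolding pd_gen_f pd_gen_g pd_gen_Ang pd_gen_Inn pd_gen_Par gen_g_def C h
    unfolding defs(1-6)[symmetric] defs(7)[symmetric] ST[symmetric] s E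
    by (simp add: power2_eq_square ring_distribs ii mult_ac)
  show "pd Ang gen_g \<rho> = \<i> * (pd Inn gen_f \<rho> + 2 * (\<rho> Par * pd Par gen_g \<rho>))"
    unfolding pd_gen_f pd_gen_g pd_gen_Ang pd_gen_Inn pd_gen_Par gen_g_def C h
    unfolding defs(1-6)[symmetric] defs(7)[symmetric] ST[symmetric]
    by (simp add: power2_eq_square ring_distribs ii mult_ac)
qed

section \<open>Powers of Gamma as Taylor coefficients in p, and the kernels\<close>

section \<open>Kernels and matrix exponential\<close>


lemma pd_funpow_taylor:
  fixes v :: "'v::finite"
  assumes "elementary F"
  shows "(\<lambda>n. (pd v ^^ n) F \<rho> / fact n * z ^ n) sums F (\<rho>(v := \<rho> v + z))"
proof -
  \<comment> \<open>The function is entire in this coordinate; the radius is chosen so that the ball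
    contains the evaluation point.\<close>
  have "(\<lambda>z. F (\<rho>(v := z))) holomorphic_on ball (\<rho> v) (norm z + 1)"
    unfolding holomorphic_on_def field_differentiable_def
    by (blast intro: has_field_derivative_at_within has_field_derivative_pd[OF assms])
  from holomorphic_power_series[OF this, of "\<rho> v + z"] show ?thesis
    by (simp add: pd_funpow_eq dist_norm)
qed

abbreviation gen_fn :: "nat \<Rightarrow> nat \<Rightarrow> (coord \<Rightarrow> complex) \<Rightarrow> complex" where
  "gen_fn k n \<equiv> (pd Ang ^^ n) ((pd Par ^^ k) gen_f)"

abbreviation gen_gn :: "nat \<Rightarrow> nat \<Rightarrow> (coord \<Rightarrow> complex) \<Rightarrow> complex" where
  "gen_gn k n \<equiv> (pd Ang ^^ n) ((pd Par ^^ k) gen_g)"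

lemma elementary_gen_fn: "elementary (gen_fn k n)" and elementary_gen_gn: "elementary (gen_gn k n)"
  by (auto intro: elementary_gen)

lemma sums_vscale: "f sums z \<Longrightarrow> (\<lambda>n. f n *s (u :: complex ^ 'k::finite)) sums (z *s u)"
  by (rule bounded_linear.sums[OF bounded_bilinear.bounded_linear_left[OF bounded_bilinear_vscale]])

text \<open>The evolution equations are differentiated \<open>k\<close> times in a and
  \<open>n\<close> times in p, and read at a = 0, where a d/da has become the factor
  \<open>k\<close>. The coefficients 2k + 1 and 2k are m - 1 and m - 2 for m = 2k + 2, as in
  \<open>Gamma_op_scal_wedge\<close>.\<close>

lemma gen_recurrence:
  assumes "\<rho> Par = 0"
  shows "gen_fn k (Suc n) \<rho> = \<i> * (((\<rho> Inn)\<^sup>2 - \<rho> Nrm) * pd Inn (gen_gn k n) \<rho> + (2 * of_nat k + 1) * \<rho> Inn * gen_gn k n \<rho>)"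
    and "gen_gn k (Suc n) \<rho> = \<i> * (pd Inn (gen_fn k n) \<rho> + 2 * of_nat k * gen_gn k n \<rho>)"
proof -
  \<comment> \<open>These coefficients depend on neither p nor a, so derivatives in both variables
    pass through them.\<close>
  define h1 h2 h3 h4 :: "(coord \<Rightarrow> complex) \<Rightarrow> complex" where
    h: "h1 = (\<lambda>\<rho>. \<i> * ((\<rho> Inn)\<^sup>2 - \<rho> Nrm))" "h2 = (\<lambda>\<rho>. \<i> * \<rho> Inn)" "h3 = (\<lambda>\<rho>. 2 * \<i> * \<rho> Inn)" "h4 = (\<lambda>\<rho>. 2 * \<i>)"
  have el_h: "elementary h1" "elementary h2" "elementary h3" "elementary h4"
    unfolding h by (intro elementary.const elementary.coord elementary.add elementary.mult elementary_diff elementary_power)+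
  have pd_h: "pd v h1 = (\<lambda>\<rho>. 0)" "pd v h2 = (\<lambda>\<rho>. 0)" "pd v h3 = (\<lambda>\<rho>. 0)" "pd v h4 = (\<lambda>\<rho>. 0)"
    if "v \<noteq> Inn" "v \<noteq> Nrm" for v
    using that by (simp_all add: pd_def h fun_eq_iff)
  have pd_i: "pd v (\<lambda>\<rho>. \<rho> Par) = (\<lambda>\<rho>. 0)" if "v \<noteq> Par" for v
    using that by (simp add: pd_coord)
  have A: "pd Ang gen_f = (\<lambda>\<rho>. (h1 \<rho> * pd Inn gen_g \<rho> + h2 \<rho> * gen_g \<rho>) + h3 \<rho> * (\<rho> Par * pd Par gen_g \<rho>))"
    "pd Ang gen_g = (\<lambda>\<rho>. \<i> * pd Inn gen_f \<rho> + h4 \<rho> * (\<rho> Par * pd Par gen_g \<rho>))"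
    by (simp_all add: fun_eq_iff gen_pde h algebra_simps)
  note el = el_h elementary_gen elementary_pd elementary_pd_funpow elementary.const elementary.coord elementary.add elementary.mult
  have B: "(pd Par ^^ k) (pd Ang gen_f) = (\<lambda>\<rho>. (h1 \<rho> * pd Inn (gen_gn k 0) \<rho> + h2 \<rho> * gen_gn k 0 \<rho>)
      + h3 \<rho> * (\<rho> Par * gen_gn (Suc k) 0 \<rho> + of_nat k * gen_gn k 0 \<rho>))"
    "(pd Par ^^ k) (pd Ang gen_g) = (\<lambda>\<rho>. \<i> * pd Inn (gen_fn k 0) \<rho>
      + h4 \<rho> * (\<rho> Par * gen_gn (Suc k) 0 \<rho> + of_nat k * gen_gn k 0 \<rho>))"
    unfolding A by (simp_all add: pd_funpow_add pd_funpow_mult_left pd_h el pd_funpow_euler pd_funpow_commute)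
  have C: "(pd Ang ^^ n) ((pd Par ^^ k) (pd Ang gen_f)) = (\<lambda>\<rho>. (h1 \<rho> * pd Inn (gen_gn k n) \<rho> + h2 \<rho> * gen_gn k n \<rho>)
      + h3 \<rho> * (\<rho> Par * gen_gn (Suc k) n \<rho> + of_nat k * gen_gn k n \<rho>))"
    "(pd Ang ^^ n) ((pd Par ^^ k) (pd Ang gen_g)) = (\<lambda>\<rho>. \<i> * pd Inn (gen_fn k n) \<rho>
      + h4 \<rho> * (\<rho> Par * gen_gn (Suc k) n \<rho> + of_nat k * gen_gn k n \<rho>))"
    unfolding B by (simp_all add: pd_funpow_add pd_funpow_mult_left pd_h pd_i el pd_funpow_commute del: funpow.simps)
  \<comment> \<open>The innermost derivative in p is moved past those in a until it reaches
    \<open>F\<close>, where the evolution equations apply.\<close>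
  have swap: "(pd Ang ^^ Suc n) ((pd Par ^^ k) F) = (pd Ang ^^ n) ((pd Par ^^ k) (pd Ang F))" if "elementary F" for F
    using that by (simp only: funpow_Suc_right comp_apply pd_funpow_commute)
  show "gen_fn k (Suc n) \<rho> = \<i> * (((\<rho> Inn)\<^sup>2 - \<rho> Nrm) * pd Inn (gen_gn k n) \<rho> + (2 * of_nat k + 1) * \<rho> Inn * gen_gn k n \<rho>)"
    unfolding swap[OF elementary_gen(5)] C using assms by (simp add: h algebra_simps)
  show "gen_gn k (Suc n) \<rho> = \<i> * (pd Inn (gen_fn k n) \<rho> + 2 * of_nat k * gen_gn k n \<rho>)"
    unfolding swap[OF elementary_gen(6)] C using assms by (simp add: h algebra_simps)
qed

lemma funpow_deriv_exp_shift: "(deriv ^^ k) (\<lambda>z. exp (z - c)) = (\<lambda>z :: complex. exp (z - c))"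
proof (induction k)
  case (Suc k)
  have "deriv (\<lambda>z. exp (z - c)) z = exp (z - c)" for z
    by (rule DERIV_imp_deriv) (auto intro!: derivative_eq_intros)
  with Suc show ?case by auto
qed simp

lemma funpow_deriv_zero: "(deriv ^^ k) (\<lambda>z :: complex. 0) = (\<lambda>z. 0)"
  by (induction k) auto

text \<open>At p = 0 the closed form reduces to exp(a - i(x, y)), which d/da reproduces. At a = 0
  all even dimensions thus share the initial value exp(-i(x, y)).\<close>

lemma gen_initial:
  assumes "\<rho> Ang = 0"
  shows "(pd Par ^^ k) gen_f \<rho> = exp (\<rho> Par - \<i> * \<rho> Inn)" and "(pd Par ^^ k) gen_g \<rho> = 0"
  using assms
  by (simp_all add: pd_funpow_eq gen_f_def gen_g_def gen_c_def gen_u_def gen_D_def gen_h_def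
      funpow_deriv_exp_shift funpow_deriv_zero cos_rt_def)

definition coord_vals :: "real \<Rightarrow> real ^ 'n \<Rightarrow> real ^ 'n \<Rightarrow> complex \<Rightarrow> coord \<Rightarrow> complex" where
  "coord_vals p x y a v = (case v of Ang \<Rightarrow> of_real p | Inn \<Rightarrow> of_real (x \<bullet> y)
     | Nrm \<Rightarrow> of_real ((norm x)\<^sup>2 * (norm y)\<^sup>2) | Par \<Rightarrow> a)"

lemma coord_vals_simps [simp]:
  "coord_vals p x y a Ang = of_real p" "coord_vals p x y a Inn = of_real (x \<bullet> y)"
  "coord_vals p x y a Nrm = of_real ((norm x)\<^sup>2 * (norm y)\<^sup>2)" "coord_vals p x y a Par = a"
  by (simp_all add: coord_vals_def)

lemma coord_vals_upd:
  "(coord_vals p x y a)(Ang := of_real q) = coord_vals q x y a"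
  "(coord_vals p x y a)(Par := b) = coord_vals p x y b"
  by (auto simp: coord_vals_def fun_eq_iff split: coord.splits)

text \<open>Along an axis of y only \<open>Inn\<close> and \<open>Nrm\<close> vary, which produces a
  gradient of the shape assumed in \<open>Gamma_op_scal_wedge\<close>.\<close>

lemma has_vector_derivative_coord_vals:
  fixes x y :: "real ^ 'n"
  assumes "elementary F"
  shows "((\<lambda>t. F (coord_vals p x (y + t *\<^sub>R axis k 1) a)) has_vector_derivative
     (pd Inn F (coord_vals p x y a) * x $ k + (pd Nrm F (coord_vals p x y a) * (2 * (norm x)\<^sup>2)) * y $ k)) (at 0)"
proof -
  have "((\<lambda>t. coord_vals p x (y + t *\<^sub>R axis k 1) a v) has_vector_derivative
      (case v of Inn \<Rightarrow> of_real (x $ k) | Nrm \<Rightarrow> of_real (2 * (norm x)\<^sup>2 * y $ k) | _ \<Rightarrow> 0)) (at 0)" for v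
  proof (cases v)
    case Inn
    have "((\<lambda>t. x \<bullet> (y + t *\<^sub>R axis k 1)) has_real_derivative x $ k) (at 0)"
      by (auto intro!: derivative_eq_intros simp: inner_add_right inner_axis)
    then show ?thesis using Inn
      by (simp add: has_vector_derivative_of_real has_real_derivative_iff_has_vector_derivative)
  next
    case Nrm
    have "(norm (y + t *\<^sub>R axis k 1))\<^sup>2 = (norm y)\<^sup>2 + 2 * t * y $ k + t\<^sup>2" for t
      unfolding power2_norm_eq_inner
      by (simp add: inner_add_left inner_add_right inner_axis inner_axis' power2_eq_square algebra_simps)
    then have "((\<lambda>t. (norm x)\<^sup>2 * (norm (y + t *\<^sub>R axis k 1))\<^sup>2) has_real_derivative 2 * (norm x)\<^sup>2 * y $ k) (at 0)"
      by (auto intro!: derivative_eq_intros)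
    then show ?thesis using Nrm
      by (simp add: has_vector_derivative_of_real has_real_derivative_iff_has_vector_derivative del: of_real_mult of_real_power)
  qed auto
  from has_vector_derivative_elementary[OF assms this] show ?thesis
    by (rule has_vector_derivative_eq_rhs) (simp add: UNIV_coord algebra_simps)
qed

text \<open>By the recurrence a derivative in p at a = 0 acts as i Gamma; the factor
  \<open>(- \<i>) ^ n\<close> compensates for the accumulated powers of i.\<close>

lemma Gamma_op_funpow_exp:
  fixes x :: "real ^ ('n::{finite,linorder})"
  assumes "CARD('n) = 2 * k + 2"
  shows "(Gamma_op ^^ n) (\<lambda>y. scal (exp (- \<i> * complex_of_real (x \<bullet> y))))
    = (\<lambda>y. scal ((- \<i>) ^ n * gen_fn k n (coord_vals 0 x y 0)) + ((- \<i>) ^ n * gen_gn k n (coord_vals 0 x y 0)) *s wedge x y)"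
proof (induction n)
  case 0
  then show ?case
    by (simp add: gen_initial)
next
  case (Suc n)
  have deriv: "((\<lambda>t. (- \<i>) ^ n * F (coord_vals 0 x (y + t *\<^sub>R axis j 1) 0)) has_vector_derivative
     (((- \<i>) ^ n * pd Inn F (coord_vals 0 x y 0)) * x $ j + ((- \<i>) ^ n * (pd Nrm F (coord_vals 0 x y 0) * (2 * (norm x)\<^sup>2))) * y $ j)) (at 0)"
    if "elementary F" for F y j
    using has_vector_derivative_mult_right[OF has_vector_derivative_coord_vals[OF that], of "(- \<i>) ^ n"]
    by (simp add: algebra_simps)
  note rec = gen_recurrence[unfolded funpow.simps comp_apply]
  show ?case
    unfolding funpow.simps comp_apply Suc
    unfolding Gamma_op_scal_wedge[OF deriv[OF elementary_gen_fn] deriv[OF elementary_gen_gn]]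
    by (intro ext, rule arg_cong2[where f = "(+)"], rule arg_cong[where f = scal],
        simp only: rec coord_vals_simps, simp add: assms algebra_simps,
        rule arg_cong2[where f = "(*s)"],
        simp only: rec coord_vals_simps, simp add: assms algebra_simps,
        rule refl)
qed

text \<open>The exponential series is the Taylor series in p about 0 of the two coefficients, and it
  converges for every p because they are entire in p.\<close>

lemma FCF_kernel_gen:
  fixes x y :: "real ^ ('n::{finite,linorder})"
  assumes "CARD('n) = 2 * k + 2"
  shows "FCF_kernel p x y = scal (gen_fn k 0 (coord_vals p x y 0)) + gen_gn k 0 (coord_vals p x y 0) *s wedge x y"
proof -
  let ?\<rho> = "coord_vals 0 x y 0"
  have upd: "?\<rho>(Ang := ?\<rho> Ang + complex_of_real p) = coord_vals p x y 0"
    by (simp add: coord_vals_upd)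
  have f: "(\<lambda>n. gen_fn k n ?\<rho> / fact n * of_real p ^ n) sums gen_fn k 0 (coord_vals p x y 0)"
    using pd_funpow_taylor[OF elementary_gen_fn[where k = k and n = 0], of Ang ?\<rho> "of_real p"] unfolding upd by simp
  have g: "(\<lambda>n. gen_gn k n ?\<rho> / fact n * of_real p ^ n) sums gen_gn k 0 (coord_vals p x y 0)"
    using pd_funpow_taylor[OF elementary_gen_gn[where k = k and n = 0], of Ang ?\<rho> "of_real p"] unfolding upd by simp
  have "(\<lambda>n. (gen_fn k n ?\<rho> / fact n * of_real p ^ n) *s blade {} + (gen_gn k n ?\<rho> / fact n * of_real p ^ n) *s wedge x y)
     sums (gen_fn k 0 (coord_vals p x y 0) *s blade {} + gen_gn k 0 (coord_vals p x y 0) *s wedge x y)"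
    by (intro sums_add sums_vscale f g)
  moreover have "(gen_fn k n ?\<rho> / fact n * of_real p ^ n) *s blade {} + (gen_gn k n ?\<rho> / fact n * of_real p ^ n) *s wedge x y
     = ((\<i> * complex_of_real p) ^ n / fact n) *s (Gamma_op ^^ n) (\<lambda>y. scal (exp (- \<i> * complex_of_real (x \<bullet> y)))) y" for n
  proof -
    have "\<i> ^ n * (- \<i>) ^ n = 1" by (simp add: power_mult_distrib[symmetric])
    then have "(\<i> * complex_of_real p) ^ n / fact n * ((- \<i>) ^ n * z) = z / fact n * of_real p ^ n" for z
      by (simp add: power_mult_distrib mult_ac)
    then show ?thesis
      unfolding Gamma_op_funpow_exp[OF assms] unfolding scal_def by (simp only: vector_add_ldistrib vector_smult_assoc)
  qed
  ultimately show ?thesis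
    by (simp add: FCF_kernel_def exp_iGamma_def scal_def sums_iff)
qed

text \<open>Cosine and sinc are even, so only the square of \<open>d_fun\<close> matters and the
  branch of \<open>csqrt\<close> is immaterial.\<close>

lemma G_closed_gen:
  "G_closed p x y a = scal (gen_f (coord_vals p x y a)) + gen_g (coord_vals p x y a) *s wedge x y"
proof -
  let ?\<rho> = "coord_vals p x y a"
  have c: "c_fun p x y a = gen_c ?\<rho>"
    by (simp add: c_fun_def gen_c_def gen_u_def cos_of_real)
  have d: "(d_fun p x y a)\<^sup>2 = gen_D ?\<rho>"
    by (simp add: d_fun_def gen_D_def gen_u_def sin_of_real power_mult_distrib)
  show ?thesis
    unfolding G_closed_def cos_rt_square[symmetric] sinc_rt_square[symmetric] d c
    by (simp add: gen_f_def gen_g_def gen_h_def scal_def vec_eq_iff sin_of_real algebra_simps)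
qed

lemma FCF_kernel_eq_clif_deriv:
  fixes x y :: "real ^ ('n::{finite,linorder})"
  assumes "CARD('n) = 2 * k + 2"
  shows "FCF_kernel p x y = clif_deriv k (G_closed p x y)"
proof -
  have "clif_deriv k (G_closed p x y) $ C = FCF_kernel p x y $ C" for C
  proof -
    \<comment> \<open>With x, y and the component \<open>C\<close> fixed, the blade and wedge
      entries are constants, and differentiation falls on \<open>gen_f\<close> and
      \<open>gen_g\<close> alone.\<close>
    let ?F = "\<lambda>\<rho>. blade {} $ C * gen_f \<rho> + wedge x y $ C * gen_g \<rho>"
    have "clif_deriv k (G_closed p x y) $ C = (pd Par ^^ k) ?F (coord_vals p x y 0)"
      by (simp add: clif_deriv_def G_closed_gen scal_def pd_funpow_eq coord_vals_upd mult.commute)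
    also have "(pd Par ^^ k) ?F = (\<lambda>\<rho>. blade {} $ C * gen_fn k 0 \<rho> + wedge x y $ C * gen_gn k 0 \<rho>)"
      by (simp add: pd_funpow_add pd_funpow_mult_left elementary_gen elementary.const elementary.mult)
    finally show ?thesis
      by (simp add: FCF_kernel_gen[OF assms] scal_def mult.commute)
  qed
  then show ?thesis by (simp add: vec_eq_iff)
qed

section \<open>The exponential of a lower triangular matrix with scalar diagonal\<close>

lemma sums_Pair: "f sums a \<Longrightarrow> g sums b \<Longrightarrow> (\<lambda>n. (f n, g n)) sums (a, b)"
proof -
  have "(\<Sum>i\<in>I. (f i, g i)) = (\<Sum>i\<in>I. f i, \<Sum>i\<in>I. g i)" for I
    by (rule prod_eqI) (simp_all add: fst_sum snd_sum)
  then show "f sums a \<Longrightarrow> g sums b \<Longrightarrow> (\<lambda>n. (f n, g n)) sums (a, b)"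
    by (auto simp: sums_def intro: tendsto_Pair)
qed

text \<open>Scalars are central, so the entry below the diagonal is \<open>X\<close> times the
  divided difference of z^n at \<open>b\<close> and \<open>b'\<close>. For equal nodes it is the
  derivative; at n = 0 the truncated exponent is harmless since the factor \<open>of_nat n\<close>
  vanishes.\<close>

lemma mpow_lower_triangular:
  "mpow ((scal b, 0), (X, scal b')) n = ((scal (b ^ n), 0),
     ((if b = b' then of_nat n * b ^ (n - 1) else (b ^ n - b' ^ n) / (b - b')) *s X, scal (b' ^ n)))"
proof (induction n)
  case (Suc n)
  let ?\<phi> = "\<lambda>n. if b = b' then of_nat n * b ^ (n - 1) else (b ^ n - b' ^ n) / (b - b')"
  have \<phi>: "?\<phi> (Suc n) = ?\<phi> n * b + b' ^ n"
    by (cases n) (auto simp: field_simps)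
  show ?case
    unfolding mpow.simps Suc mmul.simps \<phi>
    by (simp only: scal_cmul cmul_zero, simp add: scal_def vec_eq_iff algebra_simps)
qed simp

lemma sums_divided_difference_exp:
  fixes b b' :: complex
  shows "(\<lambda>n. (if b = b' then of_nat n * b ^ (n - 1) else (b ^ n - b' ^ n) / (b - b')) / fact n)
    sums (if b = b' then exp b else (exp b - exp b') / (b - b'))"
proof (cases "b = b'")
  case True
  \<comment> \<open>The term at n = 0 is zero, so the shifted series has the same sum; n / n! = 1 /
    (n - 1)! makes it the exponential series.\<close>
  have "(\<lambda>n. of_nat (Suc n) * b ^ (Suc n - 1) / fact (Suc n)) sums exp b"
    using exp_converges[of b] by (simp add: scaleR_conv_of_real field_simps del: of_nat_Suc)
  then show ?thesis using True by (subst (asm) sums_Suc_iff) simp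
next
  case False
  have "(\<lambda>n. (b ^ n /\<^sub>R fact n - b' ^ n /\<^sub>R fact n) / (b - b')) sums ((exp b - exp b') / (b - b'))"
    by (intro sums_divide sums_diff exp_converges)
  then show ?thesis using False by (simp add: scaleR_conv_of_real field_simps)
qed

lemma mexp_lower_triangular:
  fixes X :: "'n::{finite,linorder} clif"
  shows "mexp ((scal b, 0), (X, scal b')) = ((scal (exp b), 0),
     ((if b = b' then exp b else (exp b - exp b') / (b - b')) *s X, scal (exp b')))"
proof -
  let ?e = "blade {} :: 'n clif"
  have e: "(\<lambda>n. b ^ n / fact n) sums exp b" for b :: complex
    using exp_converges[of b] by (simp add: scaleR_conv_of_real field_simps)
  let ?\<phi> = "\<lambda>n. if b = b' then of_nat n * b ^ (n - 1) else (b ^ n - b' ^ n) / (b - b')"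
  have s: "(\<lambda>n. (((b ^ n / fact n) *s ?e, 0 :: 'n clif), ((?\<phi> n / fact n) *s X, (b' ^ n / fact n) *s ?e)))
    sums ((exp b *s ?e, 0 :: 'n clif), ((if b = b' then exp b else (exp b - exp b') / (b - b')) *s X, exp b' *s ?e))"
    by (intro sums_Pair sums_vscale e sums_zero sums_divided_difference_exp)
  have eq: "(\<lambda>n. (((b ^ n / fact n) *s ?e, 0 :: 'n clif), ((?\<phi> n / fact n) *s X, (b' ^ n / fact n) *s ?e)))
    = (\<lambda>n. (1 / fact n) *\<^sub>R mpow ((scal b, 0), (X, scal b')) n)"
    unfolding mpow_lower_triangular unfolding scal_def
    by (simp add: fun_eq_iff scaleR_eq_vscale)
  show ?thesis
    unfolding mexp_def using sums_unique[OF s[unfolded eq]] unfolding scal_def by (rule sym)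
qed

text \<open>The divided difference of exp at -c + d and -c - d is exp(-c) sinh d / d, and
  \<open>- d\<^sup>2 = (\<i> * d)\<^sup>2\<close> turns hyperbolic into circular functions. The
  confluent case d = 0 agrees with \<open>sinc_rt 0 = 1\<close>.\<close>

lemma exp_sum_diff:
  fixes c d :: complex
  shows "(if - c + d = - c - d then exp (- c + d) else (exp (- c + d) - exp (- c - d)) / ((- c + d) - (- c - d)))
      = exp (- c) * sinc_rt (- d\<^sup>2)"
    and "exp (- c - d) = exp (- c) * (cos_rt (- d\<^sup>2) - d * sinc_rt (- d\<^sup>2))"
proof -
  have sq: "- d\<^sup>2 = (\<i> * d)\<^sup>2" by (simp add: power_mult_distrib)
  have "\<i> * d * sinc_rt (- d\<^sup>2) = sin (\<i> * d)" unfolding sq by (rule mult_sinc_rt_square)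
  then have s: "d * sinc_rt (- d\<^sup>2) = (exp d - exp (- d)) / 2"
    by (simp add: sin_exp_eq field_simps)
  have c: "cos_rt (- d\<^sup>2) = (exp d + exp (- d)) / 2"
    unfolding sq by (simp add: cos_exp_eq mult.assoc[symmetric] add.commute)
  show "exp (- c - d) = exp (- c) * (cos_rt (- d\<^sup>2) - d * sinc_rt (- d\<^sup>2))"
    unfolding s c by (simp add: field_simps exp_diff exp_minus)
  show "(if - c + d = - c - d then exp (- c + d) else (exp (- c + d) - exp (- c - d)) / ((- c + d) - (- c - d)))
      = exp (- c) * sinc_rt (- d\<^sup>2)"
  proof (cases "d = 0")
    case False
    then have "sinc_rt (- d\<^sup>2) = (exp d - exp (- d)) / (2 * d)"
      using s by (simp add: field_simps)
    moreover have "exp (- c + d) = exp (- c) * exp d" "exp (- c - d) = exp (- c) * exp (- d)"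
      by (simp_all add: exp_add[symmetric])
    ultimately show ?thesis using False by (simp add: right_diff_distrib diff_divide_distrib)
  qed simp
qed

text \<open>The root \<open>\<delta>\<close> in the lower left entry cancels against the one from
  the lower right exponential, so that only its square, minus \<open>gen_D\<close>, survives. This
  gives the same coefficients as the closed form, for either branch of the root.\<close>

lemma G_matrix_gen:
  "G_matrix p x y a = scal (gen_f (coord_vals p x y a)) + gen_g (coord_vals p x y a) *s wedge x y"
proof -
  let ?\<rho> = "coord_vals p x y a"
  define \<delta> where "\<delta> = complex_of_real (sin p) * csqrt (- complex_of_real ((norm x)\<^sup>2 * (norm y)\<^sup>2) - (gen_u ?\<rho>)\<^sup>2)"
  define c where "c = gen_c ?\<rho>"
  have b: "beta_pm True p x y a = - c + \<delta>" "beta_pm False p x y a = - c - \<delta>"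
    by (simp_all add: beta_pm_def c_def \<delta>_def gen_c_def gen_u_def cos_of_real algebra_simps)
  have D: "- \<delta>\<^sup>2 = gen_D ?\<rho>"
    by (simp add: \<delta>_def gen_D_def sin_of_real power_mult_distrib algebra_simps)
  define Y where "Y = - (sin p) *\<^sub>R cmul (vec_cl y) (vec_cl x)
           + scal (\<i> * complex_of_real (x \<bullet> y) * exp (\<i> * complex_of_real p)
                   - a * exp (2 * \<i> * complex_of_real p) + (- c + \<delta>))"
  have B: "- B_mat p x y a = ((scal (- c + \<delta>), 0), (Y, scal (- c - \<delta>)))"
    unfolding B_mat_def b Y_def by (simp add: scal_def vec_eq_iff)
  have Y: "Y = sin p *s wedge x y + scal (\<delta> - gen_h ?\<rho>)"
  proof -
    have E2: "exp (2 * \<i> * complex_of_real p) = exp (\<i> * p) * exp (\<i> * p)"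
      by (simp add: exp_add[symmetric] algebra_simps)
    \<comment> \<open>By Euler's formula the inner product terms cancel, leaving -a e^{ip} (e^{ip} -
      cos p).\<close>
    have "sin p * (x \<bullet> y) + \<i> * complex_of_real (x \<bullet> y) * exp (\<i> * complex_of_real p)
                   - a * exp (2 * \<i> * complex_of_real p) - c = - gen_h ?\<rho>"
      unfolding c_def gen_c_def gen_u_def gen_h_def E2
      by (simp add: exp_Euler sin_of_real cos_of_real algebra_simps)
    then have h: "gen_h ?\<rho> = c + a * exp (2 * \<i> * complex_of_real p)
        - sin p * (x \<bullet> y) - \<i> * complex_of_real (x \<bullet> y) * exp (\<i> * complex_of_real p)"
      by (simp add: algebra_simps)
    show ?thesis
      unfolding Y_def cmul_vec_cl_swap scaleR_eq_vscale h
      by (simp add: scal_def vec_eq_iff algebra_simps)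
  qed
  have "G_matrix p x y a = (exp (- c) * sinc_rt (- \<delta>\<^sup>2)) *s Y + scal (exp (- c) * (cos_rt (- \<delta>\<^sup>2) - \<delta> * sinc_rt (- \<delta>\<^sup>2)))"
    unfolding G_matrix_def B mexp_lower_triangular row2_sum.simps exp_sum_diff(1) unfolding exp_sum_diff(2) ..
  then show ?thesis
    unfolding D Y by (simp add: gen_f_def gen_g_def c_def scal_def vec_eq_iff sin_of_real algebra_simps)
qed

theorem theorem8:
  fixes p :: real and x y :: "real ^ ('n::{finite,linorder})"
  assumes "even CARD('n)"
  shows "(\<forall>a. G_matrix p x y a = G_closed p x y a)
       \<and> FCF_kernel p x y = clif_deriv (CARD('n) div 2 - 1) (G_matrix p x y)
       \<and> FCF_kernel p x y = clif_deriv (CARD('n) div 2 - 1) (G_closed p x y)"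
proof -
  have G: "G_matrix p x y = G_closed p x y"
    by (rule ext) (simp only: G_matrix_gen G_closed_gen)
  \<comment> \<open>Positivity and evenness give m = 2k + 2 with k = m/2 - 1, so the natural
    subtraction does not truncate.\<close>
  have "CARD('n) > 0" by simp
  with assms have "CARD('n) = 2 * (CARD('n) div 2 - 1) + 2" by (elim evenE) simp
  from FCF_kernel_eq_clif_deriv[OF this] show ?thesis by (simp add: G)
qed

end
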